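(* For every integer $k\ge 2$ and every real $\varepsilon>0$ there exists a constant $c>0$ (depending only on $k$ and $\varepsilon$) such that the following holds for all integers $n\ge 2$ and $N\ge 1$. Let $G$ be an $N$-vertex graph with no independent set of size $n$, where $N\ge n^{k-2+\varepsilon}$, and suppose that $G$ contains at most $n^{1-\varepsilon}\cdot g(N,k,n)$ cliques of size $k$. Then for every positive integer $i<k$, $G$ contains at least $c\cdot g(N,i,n)$ cliques of size $i$.
   Context: Graphs are finite and simple. A clique of size $i$ is a set of $i$ pairwise adjacent vertices (counted as unlabeled vertex sets). $\log$ is the natural logarithm. For positive integers $N,i,n$ define $$g(N,i,n)=\binom{N}{i}\Big(\frac{\log n}{n}\Big)^{\binom{i}{2}}.$$ *)

theory Defs
  imports Complex_Main "HOL-Library.Ramsey"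
begin

text \<open>
  A finite simple graph is given by its vertex set \<open>V\<close> and its set of edges \<open>E\<close>, where
  \<open>[V]\<^bsup>2\<^esup>\<close> consists of the two-element subsets of \<open>V\<close>. Cliques and independent sets are
  the notions \<^const>\<open>clique\<close> and \<^const>\<open>indep\<close> of \<^theory>\<open>HOL-Library.Ramsey\<close>, which do not
  themselves require the set to consist of vertices; hence the use of \<open>[V]\<^bsup>i\<^esup>\<close> below.
\<close>

definition fin_simple_graph :: "'a set \<Rightarrow> 'a set set \<Rightarrow> bool" where
  "fin_simple_graph V E \<longleftrightarrow> finite V \<and> E \<subseteq> [V]\<^bsup>2\<^esup>"

definition cliques_of_size :: "'a set \<Rightarrow> 'a set set \<Rightarrow> nat \<Rightarrow> 'a set set" where
  "cliques_of_size V E i = {K \<in> [V]\<^bsup>i\<^esup>. clique K E}"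

definition indep_sets_of_size :: "'a set \<Rightarrow> 'a set set \<Rightarrow> nat \<Rightarrow> 'a set set" where
  "indep_sets_of_size V E n = {I \<in> [V]\<^bsup>n\<^esup>. indep I E}"

definition g :: "nat \<Rightarrow> nat \<Rightarrow> nat \<Rightarrow> real" where
  "g N i n = real (N choose i) * (ln (real n) / real n) ^ (i choose 2)"

end

theory Submission
  imports Defs "HOL-Real_Asymp.Real_Asymp"
begin

text \<open>
  Let \<open>K\<^sub>j\<close> be the number of \<open>j\<close>-cliques, \<open>r\<^sub>m = K\<^sub>m\<^sub>+\<^sub>1 / K\<^sub>m\<close> and \<open>N\<close> the number of vertices; it
  suffices to show \<open>r\<^sub>m \<ge> c N (log n / n)\<^sup>m\<close> for \<open>m \<le> k - 2\<close>. Up to a factor \<open>m + 1\<close>, \<open>r\<^sub>m\<close> is the average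
  size \<open>d\<close> of the common neighbourhood of an \<open>m\<close>-clique, and no such neighbourhood contains an
  independent set of size \<open>n\<close>. Turan's bound of order \<open>d\<^sup>2 / n\<close> on its number of edges gives
  \<open>r\<^sub>m\<^sub>+\<^sub>1 \<ge> r\<^sub>m / (64 n)\<close>. The missing logarithm comes from the independence number of locally sparse
  graphs: either there are at least \<open>c d\<^sup>2 log n / n\<close> edges, or at least \<open>d\<^sup>3 n\<^bsup>-2-\<delta>\<^esup>\<close> triangles. This
  dichotomy is proved with a random independent set drawn from the hard-core model at fugacity
  \<open>n\<^bsup>\<delta>/2\<^esup>\<close> over the maximum degree. If the first alternative fails for typical \<open>m\<close>-cliques, then the
  triangles make \<open>r\<^sub>m\<^sub>+\<^sub>1 r\<^sub>m\<^sub>+\<^sub>2\<close> larger than expected by a factor of order \<open>n\<^bsup>1-\<delta>\<^esup>\<close>, and Turan's bound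
  carries this excess on to \<open>K\<^sub>k\<close>, contradicting the upper bound on the number of \<open>k\<close>-cliques.
\<close>

subsection \<open>Counting cliques through common neighbourhoods\<close>

abbreviation num_cliques :: "'a set \<Rightarrow> 'a set set \<Rightarrow> nat \<Rightarrow> nat" where
  "num_cliques V E i \<equiv> card (cliques_of_size V E i)"

text \<open>The clause \<open>v \<notin> Q\<close> excludes loops: for \<open>v = q\<close> the set
  \<open>{v, q}\<close> is a singleton, and \<open>E\<close> is an arbitrary set of sets here. For
  \<open>Q = {}\<close> the result is all of \<open>V\<close>, so that \<open>m = 0\<close> is
  covered uniformly below.\<close>

definition common_nbhd :: "'a set \<Rightarrow> 'a set set \<Rightarrow> 'a set \<Rightarrow> 'a set" where
  "common_nbhd V E Q = {v \<in> V. v \<notin> Q \<and> (\<forall>q\<in>Q. {v, q} \<in> E)}"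

abbreviation nbhd :: "'a set \<Rightarrow> 'a set set \<Rightarrow> 'a \<Rightarrow> 'a set" where
  "nbhd V E v \<equiv> common_nbhd V E {v}"

lemma in_nbhd_iff: "u \<in> nbhd V E v \<longleftrightarrow> u \<in> V \<and> u \<noteq> v \<and> {u, v} \<in> E"
  by (auto simp: common_nbhd_def)

lemma common_nbhd_subset: "common_nbhd V E Q \<subseteq> V"
  by (auto simp: common_nbhd_def)

lemma finite_common_nbhd: "finite V \<Longrightarrow> finite (common_nbhd V E Q)"
  by (rule finite_subset[OF common_nbhd_subset])

lemma common_nbhd_mono: "U \<subseteq> V \<Longrightarrow> common_nbhd U E Q \<subseteq> common_nbhd V E Q"
  by (auto simp: common_nbhd_def)

lemma in_cliques_of_size_iff:
  assumes "finite V"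
  shows "K \<in> cliques_of_size V E i \<longleftrightarrow> K \<subseteq> V \<and> card K = i \<and> clique K E"
  using assms by (auto simp: cliques_of_size_def nsets_def intro: finite_subset)

lemma finite_cliques_of_size: "finite V \<Longrightarrow> finite (cliques_of_size V E i)"
  by (simp add: cliques_of_size_def finite_imp_finite_nsets)

lemma num_cliques_mono: "finite V \<Longrightarrow> U \<subseteq> V \<Longrightarrow> num_cliques U E i \<le> num_cliques V E i"
  by (rule card_mono[OF finite_cliques_of_size]) (auto simp: cliques_of_size_def nsets_def)

lemma cliques_of_size_0: "cliques_of_size V E 0 = {{}}"
  by (auto simp: cliques_of_size_def nsets_def)

lemma cliques_of_size_1: "cliques_of_size V E 1 = (\<lambda>v. {v}) ` V"
  by (auto simp: cliques_of_size_def nsets_def clique_def card_1_singleton_iff)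

lemma num_cliques_0: "num_cliques V E 0 = 1"
  by (simp add: cliques_of_size_0)

lemma num_cliques_1: "num_cliques V E 1 = card V"
  by (simp only: cliques_of_size_1) (simp add: card_image)

lemma clique_Un_common_nbhd:
  assumes "clique Q E" "clique R E" "R \<subseteq> common_nbhd V E Q"
  shows "clique (Q \<union> R) E"
proof (rule clique_Un[OF assms(1,2)])
  have "{w, v} \<in> E" if "v \<in> Q" "w \<in> R" for v w
    using assms(3) that by (auto simp: common_nbhd_def)
  then show "\<forall>v\<in>Q. \<forall>w\<in>R. v \<noteq> w \<longrightarrow> {v, w} \<in> E"
    by (metis insert_commute)
qed

text \<open>Both sides count the pairs of an \<open>m\<close>-clique \<open>Q\<close> and an \<open>(m + l)\<close>-clique containing it.\<close>

lemma sum_num_cliques_common_nbhd: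
  assumes "finite V"
  shows "(\<Sum>Q\<in>cliques_of_size V E m. num_cliques (common_nbhd V E Q) E l)
    = ((m + l) choose m) * num_cliques V E (m + l)"
proof -
  let ?A = "SIGMA Q:cliques_of_size V E m. cliques_of_size (common_nbhd V E Q) E l"
  let ?B = "SIGMA P:cliques_of_size V E (m + l). {Q. Q \<subseteq> P \<and> card Q = m}"
  have "card ?A = (\<Sum>Q\<in>cliques_of_size V E m. num_cliques (common_nbhd V E Q) E l)"
    using assms by (intro card_SigmaI) (auto simp: finite_cliques_of_size finite_common_nbhd)
  moreover have "card ?B = (\<Sum>P\<in>cliques_of_size V E (m + l). (m + l) choose m)"
  proof -
    have fin: "finite P" if "P \<in> cliques_of_size V E (m + l)" for P
      using that by (auto simp: cliques_of_size_def nsets_def)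
    have "card ?B = (\<Sum>P\<in>cliques_of_size V E (m + l). card {Q. Q \<subseteq> P \<and> card Q = m})"
      using assms fin by (intro card_SigmaI) (auto simp: finite_cliques_of_size)
    also have "\<dots> = (\<Sum>P\<in>cliques_of_size V E (m + l). (m + l) choose m)"
    proof (rule sum.cong[OF refl])
      fix P assume P: "P \<in> cliques_of_size V E (m + l)"
      then have "card P = m + l" by (auto simp: cliques_of_size_def nsets_def)
      with n_subsets[OF fin[OF P], of m] show "card {Q. Q \<subseteq> P \<and> card Q = m} = (m + l) choose m"
        by simp
    qed
    finally show ?thesis .
  qed
  moreover have "bij_betw (\<lambda>(Q, R). (Q \<union> R, Q)) ?A ?B"
  proof (rule bij_betwI[where g = "\<lambda>(P, Q). (Q, P - Q)"])
    show "(\<lambda>(Q, R). (Q \<union> R, Q)) \<in> ?A \<rightarrow> ?B"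
    proof (clarsimp)
      fix Q R assume Q: "Q \<in> cliques_of_size V E m"
        and R: "R \<in> cliques_of_size (common_nbhd V E Q) E l"
      have "R \<subseteq> common_nbhd V E Q" "clique R E" "card R = l" "finite R"
        "Q \<subseteq> V" "clique Q E" "card Q = m" "finite Q"
        using Q R by (auto simp: cliques_of_size_def nsets_def)
      moreover from this have "Q \<inter> R = {}" by (auto simp: common_nbhd_def)
      ultimately have *: "R \<subseteq> common_nbhd V E Q" "card (Q \<union> R) = m + l" "clique (Q \<union> R) E"
        by (simp_all add: clique_Un_common_nbhd card_Un_disjoint)
      with \<open>Q \<subseteq> V\<close> common_nbhd_subset[of V E Q] \<open>card Q = m\<close>
      show "Q \<union> R \<in> cliques_of_size V E (m + l) \<and> card Q = m"
        using assms by (auto simp: in_cliques_of_size_iff)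
    qed
  next
    show "(\<lambda>(P, Q). (Q, P - Q)) \<in> ?B \<rightarrow> ?A"
    proof (clarsimp)
      fix P Q assume P: "P \<in> cliques_of_size V E (card Q + l)" and Q: "Q \<subseteq> P" and m: "m = card Q"
      have fin: "finite P" "finite Q" and P': "P \<subseteq> V" "clique P E" "card P = card Q + l"
        using P Q by (auto simp: cliques_of_size_def nsets_def intro: finite_subset)
      have "P - Q \<subseteq> common_nbhd V E Q"
        using P' Q by (force simp: common_nbhd_def clique_def)
      then show "Q \<in> cliques_of_size V E (card Q) \<and>
         P - Q \<in> cliques_of_size (common_nbhd V E Q) E l"
        using P' Q fin smaller_clique[OF P'(2)] assms
        by (auto simp: in_cliques_of_size_iff finite_common_nbhd card_Diff_subset)
    qed
  next
    fix x assume x: "x \<in> ?A"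
    obtain Q R where [simp]: "x = (Q, R)" by (cases x)
    have "R \<subseteq> common_nbhd V E Q" using x by (auto simp: cliques_of_size_def nsets_def)
    then show "(case case x of (Q, R) \<Rightarrow> (Q \<union> R, Q) of (P, Q) \<Rightarrow> (Q, P - Q)) = x"
      by (auto simp: common_nbhd_def)
  qed auto
  ultimately show ?thesis
    by (simp add: bij_betw_same_card mult.commute)
qed

lemma sum_over_cliques_1:
  "(\<Sum>Q\<in>cliques_of_size V E 1. f Q) = (\<Sum>v\<in>V. f {v})"
  by (simp only: cliques_of_size_1) (simp add: sum.reindex)

text \<open>The handshake identity, obtained as the case \<open>m = l = 1\<close> of the double
  count.\<close>

lemma sum_card_nbhd:
  assumes "finite V"
  shows "(\<Sum>v\<in>V. card (nbhd V E v)) = 2 * num_cliques V E 2"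
  using sum_num_cliques_common_nbhd[OF assms, where E = E and m = 1 and l = 1] num_cliques_1[of _ E]
  by (simp only: sum_over_cliques_1) (simp add: numeral_2_eq_2)

text \<open>Each triangle is an edge in the neighbourhood of each of its three vertices.\<close>

lemma sum_num_edges_nbhd:
  assumes "finite V"
  shows "(\<Sum>v\<in>V. num_cliques (nbhd V E v) E 2) = 3 * num_cliques V E 3"
proof -
  have "(\<Sum>v\<in>V. num_cliques (nbhd V E v) E 2) = (1 + 2 choose 1) * num_cliques V E (1 + 2)"
    by (simp only: sum_over_cliques_1 flip: sum_num_cliques_common_nbhd[OF assms])
  moreover have "(1 + 2 choose 1) = (3::nat)" "1 + 2 = (3::nat)" by simp_all
  ultimately show ?thesis by (simp only:)
qed

subsection \<open>The hard-core model\<close>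

definition indep_subsets :: "'a set \<Rightarrow> 'a set set \<Rightarrow> 'a set set" where
  "indep_subsets U E = {W. W \<subseteq> U \<and> indep W E}"

text \<open>The partition function of the hard-core model on \<open>U\<close> at fugacity \<open>lam\<close>.\<close>

definition hard_core :: "'a set \<Rightarrow> 'a set set \<Rightarrow> real \<Rightarrow> real" where
  "hard_core U E lam = (\<Sum>W\<in>indep_subsets U E. lam ^ card W)"

lemma finite_indep_subsets: "finite U \<Longrightarrow> finite (indep_subsets U E)"
  by (rule finite_subset[of _ "Pow U"]) (auto simp: indep_subsets_def)

lemma finite_mem_indep_subsets: "finite U \<Longrightarrow> W \<in> indep_subsets U E \<Longrightarrow> finite W"
  by (auto simp: indep_subsets_def intro: finite_subset)

lemma empty_mem_indep_subsets: "{} \<in> indep_subsets U E"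
  by (simp add: indep_subsets_def)

lemma sum_Pow_power:
  fixes lam :: real
  assumes "finite X"
  shows "(\<Sum>B\<in>Pow X. lam ^ card B) = (1 + lam) ^ card X"
proof -
  have "(\<Prod>x\<in>X. lam + 1) = (\<Sum>B\<in>Pow X. (\<Prod>x\<in>B. lam) * (\<Prod>x\<in>X - B. 1))"
    by (rule prod_add[OF assms])
  then show ?thesis by (simp add: add.commute)
qed

lemma hard_core_le:
  assumes "finite X" "lam \<ge> 0"
  shows "hard_core X E lam \<le> (1 + lam) ^ card X"
  unfolding hard_core_def sum_Pow_power[OF assms(1), symmetric]
  using assms by (intro sum_mono2) (auto simp: indep_subsets_def)

lemma hard_core_ge_1:
  fixes X :: "'a set"
  assumes "finite X" "lam \<ge> 0"
  shows "hard_core X E lam \<ge> 1"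
proof -
  have "(\<Sum>W\<in>{{}::'a set}. lam ^ card W) \<le> hard_core X E lam"
    unfolding hard_core_def
    using assms by (intro sum_mono2) (auto simp: finite_indep_subsets empty_mem_indep_subsets)
  then show ?thesis by simp
qed

text \<open>The Markov property of the hard-core model: once the part \<open>A\<close> outside
  \<open>S\<close> is fixed, the part \<open>B\<close> inside \<open>S\<close> is an arbitrary
  independent set of vertices that have no neighbour in \<open>A\<close>.\<close>

lemma sum_indep_subsets_split:
  assumes U: "finite U" and S: "S \<subseteq> U"
  shows "(\<Sum>W\<in>indep_subsets U E. f W) =
    (\<Sum>A\<in>indep_subsets (U - S) E. \<Sum>B\<in>indep_subsets {u \<in> S. \<forall>a\<in>A. {a, u} \<notin> E} E. f (A \<union> B))"
proof -
  let ?F = "\<lambda>A. {u \<in> S. \<forall>a\<in>A. {a, u} \<notin> E}"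
  have fin: "finite (?F A)" for A using finite_subset[OF S U] by auto
  have "(\<Sum>A\<in>indep_subsets (U - S) E. \<Sum>B\<in>indep_subsets (?F A) E. f (A \<union> B))
    = (\<Sum>(A, B)\<in>(SIGMA A:indep_subsets (U - S) E. indep_subsets (?F A) E). f (A \<union> B))"
    using U fin by (intro sum.Sigma) (auto intro!: finite_indep_subsets)
  also have "\<dots> = (\<Sum>W\<in>indep_subsets U E. f W)"
  proof (rule sum.reindex_bij_witness[where i = "\<lambda>W. (W - S, W \<inter> S)" and j = "\<lambda>(A, B). A \<union> B"])
    fix p assume "p \<in> (SIGMA A:indep_subsets (U - S) E. indep_subsets (?F A) E)"
    then obtain A B where p: "p = (A, B)"
      and A: "A \<subseteq> U - S" "indep A E" and B: "B \<subseteq> ?F A" "indep B E"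
      by (auto simp: indep_subsets_def)
    show "((case p of (A, B) \<Rightarrow> A \<union> B) - S, (case p of (A, B) \<Rightarrow> A \<union> B) \<inter> S) = p"
      using A B by (auto simp: p)
    have "{a, b} \<notin> E" if "a \<in> A" "b \<in> B" for a b using that B by auto
    then have "indep (A \<union> B) E"
      using A(2) B(2) unfolding indep_def by (metis UnE insert_commute)
    then show "(case p of (A, B) \<Rightarrow> A \<union> B) \<in> indep_subsets U E"
      using A B S by (auto simp: p indep_subsets_def)
    show "f (case p of (A, B) \<Rightarrow> A \<union> B) = (case p of (A, B) \<Rightarrow> f (A \<union> B))"
      by (simp add: p)
  next
    fix W assume W: "W \<in> indep_subsets U E"
    show "(case (W - S, W \<inter> S) of (A, B) \<Rightarrow> A \<union> B) = W" by auto
    show "(W - S, W \<inter> S) \<in> (SIGMA A:indep_subsets (U - S) E. indep_subsets (?F A) E)"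
      using W by (fastforce simp: indep_subsets_def indep_def)
  qed
  finally show ?thesis by simp
qed

text \<open>A lower bound on the probability that \<open>u\<close> is chosen. Condition on the part
  outside the closed neighbourhood of \<open>u\<close>: the inside has partition function at most
  \<open>(1 + lam)\<close> to the size of that neighbourhood, and the choice \<open>{u}\<close>,
  which is never blocked, contributes \<open>lam\<close>.\<close>

lemma hard_core_vertex_weight:
  assumes U: "finite U" and u: "u \<in> U" and lam: "lam \<ge> 0"
  shows "lam * hard_core U E lam \<le> (1 + lam) ^ (card (nbhd U E u) + 1) *
    (\<Sum>W\<in>indep_subsets U E. if u \<in> W then lam ^ card W else 0)"
proof -
  define S where "S = insert u (nbhd U E u)"
  have S: "S \<subseteq> U" using u by (auto simp: S_def in_nbhd_iff)
  have finS: "finite S" using finite_subset[OF S U] .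
  have cardS: "card S = card (nbhd U E u) + 1"
    unfolding S_def using finite_common_nbhd[OF U] by (subst card_insert_disjoint) (auto simp: in_nbhd_iff)
  let ?F = "\<lambda>A. {u \<in> S. \<forall>a\<in>A. {a, u} \<notin> E}"
  have finF: "finite (?F A)" for A using finS by auto
  \<comment> \<open>The total weight of the outside parts; it links the upper bound on
    \<open>hard_core U E lam\<close> to the lower bound on the weight of the sets containing
    \<open>u\<close>.\<close>
  define w where "w = (\<Sum>A\<in>indep_subsets (U - S) E. lam ^ card A)"
  have card_Un: "card (A \<union> B) = card A + card B"
    if "A \<in> indep_subsets (U - S) E" "B \<in> indep_subsets (?F A) E" for A B
    using that U finF[of A] by (intro card_Un_disjoint) (auto simp: indep_subsets_def intro: finite_subset)
  have "hard_core U E lam = (\<Sum>A\<in>indep_subsets (U - S) E. \<Sum>B\<in>indep_subsets (?F A) E. lam ^ card (A \<union> B))"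
    unfolding hard_core_def by (rule sum_indep_subsets_split[OF U S])
  also have "\<dots> = (\<Sum>A\<in>indep_subsets (U - S) E. lam ^ card A * hard_core (?F A) E lam)"
    by (intro sum.cong refl) (simp add: hard_core_def sum_distrib_left power_add card_Un)
  also have "\<dots> \<le> (\<Sum>A\<in>indep_subsets (U - S) E. lam ^ card A * (1 + lam) ^ card S)"
  proof (intro sum_mono mult_left_mono)
    fix A
    have "hard_core (?F A) E lam \<le> (1 + lam) ^ card (?F A)"
      by (rule hard_core_le[OF finF lam])
    also have "\<dots> \<le> (1 + lam) ^ card S"
      using lam finS by (intro power_increasing card_mono) auto
    finally show "hard_core (?F A) E lam \<le> (1 + lam) ^ card S" .
  qed (use lam in auto)
  also have "\<dots> = (1 + lam) ^ card S * w"
    by (simp add: w_def sum_distrib_left mult.commute)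
  finally have 1: "hard_core U E lam \<le> (1 + lam) ^ card S * w" .
  let ?f = "\<lambda>W. if u \<in> W then lam ^ card W else 0"
  have "lam * w = (\<Sum>A\<in>indep_subsets (U - S) E. lam ^ (card A + 1))"
    by (simp add: w_def sum_distrib_left)
  also have "\<dots> \<le> (\<Sum>A\<in>indep_subsets (U - S) E. \<Sum>B\<in>indep_subsets (?F A) E. ?f (A \<union> B))"
  proof (intro sum_mono)
    fix A assume A: "A \<in> indep_subsets (U - S) E"
    have "{a, u} \<notin> E" if "a \<in> A" for a
      using that A S u by (auto simp: indep_subsets_def S_def in_nbhd_iff insert_commute)
    then have mem: "{u} \<in> indep_subsets (?F A) E"
      by (auto simp: indep_subsets_def S_def indep_def)
    have "lam ^ (card A + 1) = (\<Sum>B\<in>{{u}}. ?f (A \<union> B))"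
      using card_Un[OF A mem] by simp
    also have "\<dots> \<le> (\<Sum>B\<in>indep_subsets (?F A) E. ?f (A \<union> B))"
      using mem finite_indep_subsets[OF finF[of A]] lam by (intro sum_mono2) auto
    finally show "lam ^ (card A + 1) \<le> \<dots>" .
  qed
  also have "\<dots> = (\<Sum>W\<in>indep_subsets U E. ?f W)"
    by (rule sum_indep_subsets_split[OF U S, symmetric])
  finally have 2: "lam * w \<le> (\<Sum>W\<in>indep_subsets U E. ?f W)" .
  have "lam * hard_core U E lam \<le> lam * ((1 + lam) ^ card S * w)"
    using 1 lam by (rule mult_left_mono)
  also have "\<dots> = (1 + lam) ^ card S * (lam * w)" by simp
  also have "\<dots> \<le> (1 + lam) ^ card S * (\<Sum>W\<in>indep_subsets U E. ?f W)"
    using 2 lam by (intro mult_left_mono) auto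
  finally show ?thesis by (simp add: cardS)
qed

lemma one_plus_power_le_exp:
  fixes x :: real
  assumes "x \<ge> 0"
  shows "(1 + x) ^ m \<le> exp (x * real m)"
  using power_mono[OF exp_ge_add_one_self[of x], of m] assms
  by (simp add: exp_of_nat_mult[symmetric] mult.commute)

lemma exp_2_le_9: "exp (2::real) \<le> 9"
proof -
  have "exp (2::real) = exp 1 * exp 1" by (simp flip: exp_add)
  also have "\<dots> \<le> 3 * 3"
    by (intro mult_mono exp_le) auto
  finally show ?thesis by simp
qed

text \<open>Markov's inequality.\<close>

lemma card_large_values_le:
  fixes f :: "'a \<Rightarrow> real"
  assumes U: "finite U" and nonneg: "\<And>u. u \<in> U \<Longrightarrow> f u \<ge> 0" and T: "T > 0"
    and le: "(\<Sum>u\<in>U. f u) \<le> r * T"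
  shows "real (card {u \<in> U. f u > T}) \<le> r"
proof -
  let ?H = "{u \<in> U. f u > T}"
  have "real (card ?H) * T = (\<Sum>u\<in>?H. T)" by simp
  also have "\<dots> \<le> (\<Sum>u\<in>?H. f u)" by (intro sum_mono) auto
  also have "\<dots> \<le> (\<Sum>u\<in>U. f u)" using U nonneg by (intro sum_mono2) auto
  also note le
  finally show ?thesis using T by simp
qed

text \<open>\<open>X\<close> will be the set of vertices of a neighbourhood that are not blocked by the part of a random
  independent set outside it. If \<open>X\<close> is small, then the centre of the neighbourhood is likely to be
  chosen (first summand); if \<open>X\<close> is large, then it contains many chosen vertices.\<close>

lemma hard_core_local:
  fixes X :: "'a set"
  assumes X: "finite X" and lam: "0 < lam" "lam \<le> 1" and s: "s > 0"
    and edges: "real (num_cliques X E 2) \<le> s" and sparse: "4 * s * lam\<^sup>2 \<le> 1"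
    and l: "l \<ge> 1" and M: "M * lam \<ge> exp (2 * l)"
  shows "l / 36 * (lam + hard_core X E lam)
    \<le> M * lam + (\<Sum>B\<in>indep_subsets X E. real (card B) * lam ^ card B)"
    (is "_ \<le> M * lam + ?S")
proof (cases "lam * real (card X) \<le> l")
  \<comment> \<open>Here \<open>hard_core X E lam \<le> exp l\<close>, so the left side is at most
    \<open>exp (2 * l)\<close>, which \<open>M * lam\<close> reaches by itself.\<close>
  case True
  have "hard_core X E lam \<le> exp (lam * real (card X))"
    using hard_core_le[OF X, of lam E] one_plus_power_le_exp[of lam "card X"] lam by linarith
  also have "\<dots> \<le> exp l" using True by simp
  finally have "lam + hard_core X E lam \<le> 2 * exp l"
    using lam exp_ge_add_one_self[of l] l by linarith
  then have "l / 36 * (lam + hard_core X E lam) \<le> l / 36 * (2 * exp l)"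
    using l by (intro mult_left_mono) auto
  also have "\<dots> \<le> exp l * exp l"
  proof -
    have "l \<le> 18 * exp l" using exp_ge_add_one_self[of l] l by linarith
    then show ?thesis by simp
  qed
  also have "\<dots> = exp (2 * l)" by (simp flip: exp_add)
  also note M
  also have "M * lam \<le> M * lam + ?S"
    using lam by (simp add: sum_nonneg)
  finally show ?thesis .
next
  case False
  define x where "x = real (card X)"
  have x: "lam * x > l" using False by (simp add: x_def)
  then have x0: "x > 0" using l lam by (metis less_le_trans less_trans zero_less_mult_pos zero_less_one)
  define Z where "Z = hard_core X E lam"
  have Z1: "Z \<ge> 1" unfolding Z_def using hard_core_ge_1[OF X] lam by auto
  \<comment> \<open>The average degree in \<open>X\<close> is at most \<open>2 * s / x\<close>, so
    at most half of the vertices exceed twice this value.\<close>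
  define H where "H = {u \<in> X. real (card (nbhd X E u)) > 4 * s / x}"
  have H: "2 * real (card H) \<le> x"
  proof -
    have "(\<Sum>u\<in>X. real (card (nbhd X E u))) = 2 * real (num_cliques X E 2)"
      using sum_card_nbhd[OF X, of E] by (metis of_nat_sum of_nat_mult of_nat_numeral)
    also have "\<dots> \<le> x / 2 * (4 * s / x)" using edges x0 by simp
    finally have "real (card H) \<le> x / 2"
      unfolding H_def using X s x0 by (intro card_large_values_le) auto
    then show ?thesis by simp
  qed
  have cardXH: "real (card (X - H)) \<ge> x / 2"
  proof -
    have "H \<subseteq> X" by (auto simp: H_def)
    then have "card (X - H) = card X - card H" "card H \<le> card X"
      using X by (auto simp: card_Diff_subset card_mono finite_subset)
    then show ?thesis using H by (simp add: x_def of_nat_diff)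
  qed
  let ?w = "\<lambda>u. \<Sum>B\<in>indep_subsets X E. if u \<in> B then lam ^ card B else 0"
  \<comment> \<open>Outside \<open>H\<close> the degree times \<open>lam\<close> is at most
    \<open>4 * s * lam\<^sup>2 / (lam * x) \<le> 1\<close>, so \<open>(1 + lam)\<close> to the
    degree plus one is at most \<open>exp 2 \<le> 9\<close>, and such a vertex is chosen with
    probability at least \<open>lam / 9\<close>.\<close>
  have low: "?w u \<ge> lam * Z / 9" if u: "u \<in> X - H" for u
  proof -
    have "lam * real (card (nbhd X E u)) \<le> lam * (4 * s / x)"
      using u lam by (intro mult_left_mono) (auto simp: H_def)
    also have "\<dots> = 4 * s * lam\<^sup>2 / (lam * x)"
      using lam x0 by (simp add: field_simps power2_eq_square)
    also have "\<dots> \<le> 1 / 1"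
      using sparse x l s by (intro frac_le) auto
    finally have "lam * real (card (nbhd X E u) + 1) \<le> 2" using lam by (simp add: algebra_simps)
    then have "exp (lam * real (card (nbhd X E u) + 1)) \<le> exp 2" by (simp only: exp_le_cancel_iff)
    then have 9: "(1 + lam) ^ (card (nbhd X E u) + 1) \<le> 9"
      using one_plus_power_le_exp[of lam "card (nbhd X E u) + 1"] lam exp_2_le_9 by linarith
    have "lam * Z \<le> (1 + lam) ^ (card (nbhd X E u) + 1) * ?w u"
      unfolding Z_def using hard_core_vertex_weight[OF X, of u lam E] u lam by auto
    also have "\<dots> \<le> 9 * ?w u"
      using 9 lam by (intro mult_right_mono sum_nonneg) auto
    finally show ?thesis by simp
  qed
  have "?S = (\<Sum>B\<in>indep_subsets X E. \<Sum>u\<in>X. if u \<in> B then lam ^ card B else 0)"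
  proof (intro sum.cong refl)
    fix B assume "B \<in> indep_subsets X E"
    then have "X \<inter> B = B" by (auto simp: indep_subsets_def)
    then show "real (card B) * lam ^ card B = (\<Sum>u\<in>X. if u \<in> B then lam ^ card B else 0)"
      using X by (simp flip: sum.inter_restrict)
  qed
  also have "\<dots> = (\<Sum>u\<in>X. ?w u)" by (rule sum.swap)
  also have "\<dots> \<ge> (\<Sum>u\<in>X - H. ?w u)"
    using X lam by (intro sum_mono2) (auto intro!: sum_nonneg)
  finally have "(\<Sum>u\<in>X - H. ?w u) \<le> ?S" .
  moreover have "(\<Sum>u\<in>X - H. lam * Z / 9) \<le> (\<Sum>u\<in>X - H. ?w u)"
    using low by (rule sum_mono)
  \<comment> \<open>The at least \<open>x / 2\<close> vertices outside \<open>H\<close> give an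
    expected number of chosen vertices of at least \<open>lam * x / 18 \<ge> l / 18\<close>. The
    remaining factor 2 in 36 pays for \<open>lam + Z \<le> 2 * Z\<close>.\<close>
  moreover have "l * Z / 18 \<le> (\<Sum>u\<in>X - H. lam * Z / 9)"
  proof -
    have "l * Z / 18 \<le> lam * x * Z / 18"
      using x Z1 by (intro divide_right_mono mult_right_mono) auto
    also have "\<dots> = x / 2 * (lam * Z / 9)" by simp
    also have "\<dots> \<le> real (card (X - H)) * (lam * Z / 9)"
      using cardXH lam Z1 by (intro mult_right_mono) auto
    finally show ?thesis by simp
  qed
  moreover have "l / 36 * (lam + Z) \<le> l / 36 * (2 * Z)"
    using l lam Z1 by (intro mult_left_mono) auto
  moreover have "M * lam \<ge> 0" using M by (smt (verit) exp_gt_zero)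
  ultimately show ?thesis unfolding Z_def by simp
qed

text \<open>Averaging over the hard-core model and over all vertices. For each \<open>v\<close>, the
  quantity \<open>M\<close> times the indicator of \<open>v \<in> W\<close>, plus the number of
  neighbours of \<open>v\<close> in \<open>W\<close>, has expectation at least \<open>l / 36\<close>
  by \<open>hard_core_local\<close>. For fixed \<open>W\<close> its sum over \<open>v\<close> is at
  most \<open>2 * M * card W\<close>, since degrees are at most \<open>M\<close>.\<close>

lemma hard_core_global:
  fixes U :: "'a set"
  assumes U: "finite U" and lam: "0 < lam" "lam \<le> 1" and s: "s > 0"
    and edges: "\<And>v. v \<in> U \<Longrightarrow> real (num_cliques (nbhd U E v) E 2) \<le> s"
    and sparse: "4 * s * lam\<^sup>2 \<le> 1" and l: "l \<ge> 1" and M: "M * lam \<ge> exp (2 * l)"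
    and deg: "\<And>v. v \<in> U \<Longrightarrow> real (card (nbhd U E v)) \<le> M"
    and indep: "\<And>W. W \<in> indep_subsets U E \<Longrightarrow> card W \<le> n"
  shows "real (card U) * (l / 36) \<le> 2 * M * real n"
proof -
  define Z where "Z = hard_core U E lam"
  have Z1: "Z \<ge> 1" unfolding Z_def using hard_core_ge_1[OF U] lam by auto
  have "M * lam \<ge> 0" using M by (smt (verit) exp_gt_zero)
  then have M0: "M \<ge> 0" using lam by (simp add: zero_le_mult_iff)
  let ?f = "\<lambda>v W. (M * (if v \<in> W then 1 else 0) + real (card (W \<inter> nbhd U E v))) * lam ^ card W"
  have vertex: "l / 36 * Z \<le> (\<Sum>W\<in>indep_subsets U E. ?f v W)" if v: "v \<in> U" for v
  proof -
    define Nv where "Nv = nbhd U E v"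
    define S where "S = insert v Nv"
    have S: "S \<subseteq> U" using v by (auto simp: S_def Nv_def in_nbhd_iff)
    have finS: "finite S" using finite_subset[OF S U] .
    let ?F = "\<lambda>A. {u \<in> S. \<forall>a\<in>A. {a, u} \<notin> E}"
    let ?X = "\<lambda>A. {u \<in> Nv. \<forall>a\<in>A. {a, u} \<notin> E}"
    have finX: "finite (?X A)" for A using finS by (auto simp: S_def)
    have finF: "finite (?F A)" for A using finS by auto
    \<comment> \<open>Given \<open>A\<close>, either \<open>v\<close> is chosen and excludes all its
      neighbours, or the choice is an independent set of unblocked neighbours \<open>?X A\<close>.
      As \<open>A\<close> avoids the neighbours of \<open>v\<close>, it never blocks
      \<open>v\<close>. Hence the local partition function is
      \<open>lam + hard_core (?X A) E lam\<close>.\<close>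
    have F_split: "indep_subsets (?F A) E = insert {v} (indep_subsets (?X A) E)"
      if A: "A \<in> indep_subsets (U - S) E" for A
    proof
      have free: "{a, v} \<notin> E" if "a \<in> A" for a
        using that A S v by (auto simp: indep_subsets_def S_def Nv_def in_nbhd_iff insert_commute)
      show "insert {v} (indep_subsets (?X A) E) \<subseteq> indep_subsets (?F A) E"
        using free by (auto simp: indep_subsets_def S_def indep_def)
      show "indep_subsets (?F A) E \<subseteq> insert {v} (indep_subsets (?X A) E)"
      proof
        fix B assume B: "B \<in> indep_subsets (?F A) E"
        show "B \<in> insert {v} (indep_subsets (?X A) E)"
        proof (cases "v \<in> B")
          case True
          have "indep B E" "B \<subseteq> S" using B by (auto simp: indep_subsets_def)
          have "u = v" if u: "u \<in> B" for u
          proof (rule ccontr)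
            assume "u \<noteq> v"
            then have "{u, v} \<notin> E" using \<open>indep B E\<close> u True by (simp add: indep_def)
            moreover have "u \<in> S" using u \<open>B \<subseteq> S\<close> by blast
            ultimately show False using \<open>u \<noteq> v\<close> by (simp add: S_def Nv_def in_nbhd_iff)
          qed
          then have "B = {v}" using True by blast
          then show ?thesis by simp
        next
          case False
          then show ?thesis using B by (auto simp: indep_subsets_def S_def)
        qed
      qed
    qed
    have split: "(\<Sum>W\<in>indep_subsets U E. f W) = (\<Sum>A\<in>indep_subsets (U - S) E.
        f (A \<union> {v}) + (\<Sum>B\<in>indep_subsets (?X A) E. f (A \<union> B)))" for f :: "'a set \<Rightarrow> real"
    proof -
      have "(\<Sum>W\<in>indep_subsets U E. f W) =
        (\<Sum>A\<in>indep_subsets (U - S) E. \<Sum>B\<in>indep_subsets (?F A) E. f (A \<union> B))"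
        by (rule sum_indep_subsets_split[OF U S])
      also have "\<dots> = (\<Sum>A\<in>indep_subsets (U - S) E.
        f (A \<union> {v}) + (\<Sum>B\<in>indep_subsets (?X A) E. f (A \<union> B)))"
      proof (intro sum.cong refl)
        fix A assume A: "A \<in> indep_subsets (U - S) E"
        have "{v} \<notin> indep_subsets (?X A) E"
          by (auto simp: indep_subsets_def Nv_def in_nbhd_iff)
        then show "(\<Sum>B\<in>indep_subsets (?F A) E. f (A \<union> B))
          = f (A \<union> {v}) + (\<Sum>B\<in>indep_subsets (?X A) E. f (A \<union> B))"
          unfolding F_split[OF A] by (rule sum.insert[OF finite_indep_subsets[OF finX]])
      qed
      finally show ?thesis .
    qed
    have finA: "finite A" if "A \<in> indep_subsets (U - S) E" for A
      using finite_mem_indep_subsets[OF _ that] U by auto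
    have finB: "finite B" if "B \<in> indep_subsets (?X A) E" for A B
      using finite_mem_indep_subsets[OF finX that] .
    have cardAv: "card (A \<union> {v}) = card A + 1" if "A \<in> indep_subsets (U - S) E" for A
      using that finA[OF that] by (subst card_Un_disjoint) (auto simp: indep_subsets_def S_def)
    have cardAB: "card (A \<union> B) = card A + card B"
      if "A \<in> indep_subsets (U - S) E" "B \<in> indep_subsets (?X A) E" for A B
      using that finA[OF that(1)] finB[OF that(2)]
      by (subst card_Un_disjoint) (auto simp: indep_subsets_def S_def)
    have Z: "Z = (\<Sum>A\<in>indep_subsets (U - S) E. lam ^ card A * (lam + hard_core (?X A) E lam))"
      unfolding Z_def hard_core_def[of U] split
      by (intro sum.cong refl)
        (simp add: cardAv cardAB power_add hard_core_def sum_distrib_left algebra_simps del: Un_insert_right)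
    have "(\<Sum>W\<in>indep_subsets U E. ?f v W) = (\<Sum>A\<in>indep_subsets (U - S) E.
        ?f v (A \<union> {v}) + (\<Sum>B\<in>indep_subsets (?X A) E. ?f v (A \<union> B)))"
      by (rule split)
    also have "\<dots> = (\<Sum>A\<in>indep_subsets (U - S) E. lam ^ card A *
        (M * lam + (\<Sum>B\<in>indep_subsets (?X A) E. real (card B) * lam ^ card B)))"
    proof (intro sum.cong refl)
      fix A assume A: "A \<in> indep_subsets (U - S) E"
      have "(A \<union> {v}) \<inter> nbhd U E v = {}"
        using A by (auto simp: indep_subsets_def S_def Nv_def in_nbhd_iff)
      then have 1: "?f v (A \<union> {v}) = lam ^ card A * (M * lam)"
        using cardAv[OF A] by simp
      have 2: "?f v (A \<union> B) = lam ^ card A * (real (card B) * lam ^ card B)"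
        if B: "B \<in> indep_subsets (?X A) E" for B
      proof -
        have "v \<notin> A \<union> B" "(A \<union> B) \<inter> nbhd U E v = B"
          using A B by (auto simp: indep_subsets_def S_def Nv_def in_nbhd_iff)
        then show ?thesis using cardAB[OF A B] by (simp add: power_add)
      qed
      show "?f v (A \<union> {v}) + (\<Sum>B\<in>indep_subsets (?X A) E. ?f v (A \<union> B)) = lam ^ card A *
        (M * lam + (\<Sum>B\<in>indep_subsets (?X A) E. real (card B) * lam ^ card B))"
        unfolding 1 using 2 by (simp add: distrib_left sum_distrib_left)
    qed
    also have "\<dots> \<ge> (\<Sum>A\<in>indep_subsets (U - S) E. lam ^ card A *
        (l / 36 * (lam + hard_core (?X A) E lam)))"
    proof (intro sum_mono mult_left_mono)
      fix A
      have "real (num_cliques (?X A) E 2) \<le> real (num_cliques Nv E 2)"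
        using finS by (intro of_nat_mono num_cliques_mono) (auto simp: S_def)
      also have "\<dots> \<le> s" unfolding Nv_def by (rule edges[OF v])
      finally show "l / 36 * (lam + hard_core (?X A) E lam)
        \<le> M * lam + (\<Sum>B\<in>indep_subsets (?X A) E. real (card B) * lam ^ card B)"
        by (intro hard_core_local[OF finX lam s _ sparse l M])
    qed (use lam in auto)
    also have "(\<Sum>A\<in>indep_subsets (U - S) E. lam ^ card A *
        (l / 36 * (lam + hard_core (?X A) E lam))) = l / 36 * Z"
      unfolding Z sum_distrib_left by (intro sum.cong refl) simp
    finally show ?thesis .
  qed
  have "real (card U) * (l / 36) * Z = (\<Sum>v\<in>U. l / 36 * Z)" by simp
  also have "\<dots> \<le> (\<Sum>v\<in>U. \<Sum>W\<in>indep_subsets U E. ?f v W)"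
    using vertex by (rule sum_mono)
  also have "\<dots> = (\<Sum>W\<in>indep_subsets U E. \<Sum>v\<in>U. ?f v W)" by (rule sum.swap)
  also have "\<dots> \<le> (\<Sum>W\<in>indep_subsets U E. 2 * M * real n * lam ^ card W)"
  proof (rule sum_mono)
    fix W assume W: "W \<in> indep_subsets U E"
    have WU: "W \<subseteq> U" using W by (auto simp: indep_subsets_def)
    have finW: "finite W" using finite_subset[OF WU U] .
    \<comment> \<open>Double counting of adjacent pairs with one end in \<open>W\<close> turns the
      sum over \<open>v\<close> into the sum of the degrees of the members of
      \<open>W\<close>.\<close>
    have "(\<Sum>v\<in>U. card (W \<inter> nbhd U E v)) = (\<Sum>v\<in>U. \<Sum>u\<in>W. if u \<in> nbhd U E v then 1 else 0)"
      using finW by (intro sum.cong refl) (simp flip: sum.inter_restrict)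
    also have "\<dots> = (\<Sum>u\<in>W. \<Sum>v\<in>U. if u \<in> nbhd U E v then 1 else 0)" by (rule sum.swap)
    also have "\<dots> = (\<Sum>u\<in>W. card (nbhd U E u))"
    proof (intro sum.cong refl)
      fix u assume "u \<in> W"
      then have "U \<inter> {v. u \<in> nbhd U E v} = nbhd U E u"
        using WU by (auto simp: in_nbhd_iff insert_commute)
      then show "(\<Sum>v\<in>U. if u \<in> nbhd U E v then 1 else 0) = card (nbhd U E u)"
        using U by (simp add: sum.If_cases)
    qed
    finally have "(\<Sum>v\<in>U. real (card (W \<inter> nbhd U E v))) = (\<Sum>u\<in>W. real (card (nbhd U E u)))"
      by (metis of_nat_sum)
    also have "\<dots> \<le> (\<Sum>u\<in>W. M)" using deg WU by (intro sum_mono) auto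
    finally have 1: "(\<Sum>v\<in>U. real (card (W \<inter> nbhd U E v))) \<le> M * real (card W)" by (simp add: mult.commute)
    have "U \<inter> W = W" using WU by auto
    then have 2: "(\<Sum>v\<in>U. M * (if v \<in> W then 1 else 0)) = M * real (card W)"
      using U by (simp add: sum.If_cases flip: sum_distrib_left)
    have "(\<Sum>v\<in>U. ?f v W) = ((\<Sum>v\<in>U. M * (if v \<in> W then 1 else 0)) +
        (\<Sum>v\<in>U. real (card (W \<inter> nbhd U E v)))) * lam ^ card W"
      by (simp only: sum_distrib_right sum.distrib distrib_right)
    also have "\<dots> \<le> (2 * M * real (card W)) * lam ^ card W"
      using 1 2 lam by (intro mult_right_mono) auto
    also have "\<dots> \<le> (2 * M * real n) * lam ^ card W"
      using indep[OF W] lam M0 by (intro mult_right_mono mult_left_mono) auto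
    finally show "(\<Sum>v\<in>U. ?f v W) \<le> 2 * M * real n * lam ^ card W" by simp
  qed
  also have "\<dots> = 2 * M * real n * Z" by (simp add: Z_def hard_core_def sum_distrib_left)
  finally show ?thesis using Z1 by simp
qed

subsection \<open>Graphs without large independent sets\<close>

lemma card_indep_subset_less:
  assumes "finite U" "indep_sets_of_size U E n = {}" "W \<in> indep_subsets U E"
  shows "card W < n"
proof (rule ccontr)
  assume "\<not> card W < n"
  then obtain W' where W': "W' \<subseteq> W" "card W' = n" "finite W'"
    using obtain_subset_with_card_n[of n W] by auto
  then have "W' \<in> indep_sets_of_size U E n"
    using assms(3) smaller_indep[of W E W']
    by (auto simp: indep_sets_of_size_def indep_subsets_def nsets_def)
  with assms(2) show False by simp
qed

lemma indep_sets_of_size_subset_empty: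
  assumes "U \<subseteq> V" "indep_sets_of_size V E n = {}"
  shows "indep_sets_of_size U E n = {}"
  using assms by (auto simp: indep_sets_of_size_def nsets_def)

text \<open>If both alternatives fail, at most half of the vertices have too large a degree or too
  many edges in their neighbourhood. After their removal, \<open>hard_core_global\<close> bounds the
  number of vertices from above, which is a contradiction.\<close>

lemma triangle_count_or_edge_count_large:
  assumes U: "finite U" and indep: "indep_sets_of_size U E n = {}"
    and \<delta>: "\<delta> > 0" and n: "\<delta> * ln (real n) \<ge> 5600"
    and d: "real (card U) \<ge> real n powr (1 + \<delta>)"
  shows "real (num_cliques U E 2) \<ge> \<delta> / 6400 * (real (card U))\<^sup>2 * (ln (real n) / real n)
    \<or> real (num_cliques U E 3) \<ge> (real (card U)) ^ 3 * real n powr (- 2 - \<delta>)"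
proof (rule ccontr)
  assume contra: "\<not> ?thesis"
  define d where "d = real (card U)"
  define L where "L = ln (real n)"
  have n0: "n > 0" using n \<delta> by (cases "n = 0") auto
  have L: "\<delta> * L \<ge> 5600" using n by (simp add: L_def)
  have L0: "L > 0" using L \<delta> by (smt (verit) mult_nonneg_nonpos)
  have nd: "real n * real n powr \<delta> \<le> d"
    using d n0 by (simp add: d_def powr_add)
  have d0: "d > 0" using nd n0 by (smt (verit) mult_pos_pos of_nat_0_less_iff powr_gt_zero)
  \<comment> \<open>If both alternatives fail, \<open>M\<close> and \<open>s\<close> are at least
    four times the average degree and the average number of edges in a neighbourhood, so Markov
    discards at most a quarter of \<open>U\<close> each. \<open>lam\<close> and \<open>l\<close> are
    matched by \<open>M * lam = n powr (\<delta> / 2) = exp (2 * l)\<close>.\<close>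
  define M where "M = \<delta> / 800 * d * L / real n"
  define s where "s = 12 * d\<^sup>2 * real n powr (- 2 - \<delta>)"
  define lam where "lam = real n powr (\<delta> / 2) / M"
  define l where "l = \<delta> / 4 * L"
  have M0: "M > 0" using \<delta> d0 L0 n0 by (simp add: M_def)
  have s0: "s > 0" using d0 n0 by (simp add: s_def)
  have lam0: "lam > 0" using M0 n0 by (simp add: lam_def)
  have lam1: "lam \<le> 1"
  proof -
    have "real n powr (\<delta> / 2) \<le> real n powr \<delta>" using n0 \<delta> by (intro powr_mono) auto
    also have "\<dots> \<le> d / real n" using nd n0 by (simp add: field_simps)
    also have "\<dots> \<le> (\<delta> / 800 * L) * (d / real n)"
      using mult_right_mono[of 1 "\<delta> / 800 * L" "d / real n"] L d0 by simp
    also have "\<dots> = M" by (simp add: M_def)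
    finally show ?thesis using M0 by (simp add: lam_def)
  qed
  have sparse: "4 * s * lam\<^sup>2 \<le> 1"
  proof -
    have p: "real n powr (- 2 - \<delta>) = 1 / ((real n)\<^sup>2 * real n powr \<delta>)"
      using n0 by (simp add: powr_diff powr_minus powr_realpow field_simps)
    have q: "(real n powr (\<delta> / 2))\<^sup>2 = real n powr \<delta>"
      using n0 by (simp add: powr_power)
    \<comment> \<open>The powers of \<open>n\<close> and \<open>d\<close> cancel. Since 5600 = 7 *
      800, the base is at least 7, and 48 < 49.\<close>
    have "4 * s * lam\<^sup>2 = 48 / (\<delta> / 800 * L)\<^sup>2"
      using n0 d0 L0 \<delta> by (simp add: s_def lam_def M_def p q power_divide power_mult_distrib field_simps)
    also have "\<dots> \<le> 48 / 7\<^sup>2"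
      using L by (intro divide_left_mono power_mono) auto
    finally show ?thesis by simp
  qed
  have l1: "l \<ge> 1" using L by (simp add: l_def)
  have Mlam: "M * lam \<ge> exp (2 * l)"
    using M0 n0 by (simp add: lam_def l_def L_def powr_def)
  define H1 where "H1 = {u \<in> U. real (card (nbhd U E u)) > M}"
  define H2 where "H2 = {u \<in> U. real (num_cliques (nbhd U E u) E 2) > s}"
  have H1: "real (card H1) \<le> d / 4"
    unfolding H1_def
  proof (rule card_large_values_le[OF U _ M0])
    have "(\<Sum>u\<in>U. real (card (nbhd U E u))) = 2 * real (num_cliques U E 2)"
      using sum_card_nbhd[OF U, of E] by (metis of_nat_sum of_nat_mult of_nat_numeral)
    also have "\<dots> \<le> 2 * (\<delta> / 6400 * d\<^sup>2 * (L / real n))"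
      using contra unfolding d_def L_def by linarith
    also have "\<dots> = d / 4 * M" by (simp add: M_def power2_eq_square)
    finally show "(\<Sum>u\<in>U. real (card (nbhd U E u))) \<le> d / 4 * M" .
  qed auto
  have H2: "real (card H2) \<le> d / 4"
    unfolding H2_def
  proof (rule card_large_values_le[OF U _ s0])
    have "(\<Sum>u\<in>U. real (num_cliques (nbhd U E u) E 2)) = 3 * real (num_cliques U E 3)"
      using sum_num_edges_nbhd[OF U, of E] by (metis of_nat_sum of_nat_mult of_nat_numeral)
    also have "\<dots> \<le> d / 4 * s"
      using contra by (simp add: s_def d_def power2_eq_square power3_eq_cube)
    finally show "(\<Sum>u\<in>U. real (num_cliques (nbhd U E u) E 2)) \<le> d / 4 * s" .
  qed auto
  define U' where "U' = U - (H1 \<union> H2)"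
  have U'U: "U' \<subseteq> U" by (auto simp: U'_def)
  have finU': "finite U'" using U by (simp add: U'_def)
  have cardU': "real (card U') \<ge> d / 2"
  proof -
    have "card (H1 \<union> H2) \<le> card H1 + card H2" by (rule card_Un_le)
    then have "real (card (H1 \<union> H2)) \<le> d / 2" using H1 H2 by linarith
    moreover have "card U - card (H1 \<union> H2) \<le> card U'"
      unfolding U'_def by (rule diff_card_le_card_Diff) (use U in \<open>auto simp: H1_def H2_def\<close>)
    ultimately show ?thesis unfolding d_def by linarith
  qed
  \<comment> \<open>With at least half of \<open>U\<close> left, this yields
    \<open>d * (\<delta> * L) / 288 \<le> d * (\<delta> * L) / 400\<close>.\<close>
  have "real (card U') * (l / 36) \<le> 2 * M * real n"
  proof (rule hard_core_global[OF finU' lam0 lam1 s0 _ sparse l1 Mlam])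
    fix v assume v: "v \<in> U'"
    have "num_cliques (nbhd U' E v) E 2 \<le> num_cliques (nbhd U E v) E 2"
      by (intro num_cliques_mono common_nbhd_mono U'U finite_common_nbhd U)
    moreover have "real (num_cliques (nbhd U E v) E 2) \<le> s" using v by (auto simp: U'_def H2_def)
    ultimately show "real (num_cliques (nbhd U' E v) E 2) \<le> s" by linarith
    have "card (nbhd U' E v) \<le> card (nbhd U E v)"
      by (intro card_mono common_nbhd_mono U'U finite_common_nbhd U)
    moreover have "real (card (nbhd U E v)) \<le> M" using v by (auto simp: U'_def H1_def)
    ultimately show "real (card (nbhd U' E v)) \<le> M" by linarith
  next
    fix W assume "W \<in> indep_subsets U' E"
    then show "card W \<le> n"
      using card_indep_subset_less[OF finU' indep_sets_of_size_subset_empty[OF U'U indep]]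
      by (simp add: less_imp_le)
  qed
  moreover have "d / 2 * (l / 36) \<le> real (card U') * (l / 36)"
    using cardU' l1 by (intro mult_right_mono) auto
  moreover have "2 * M * real n = d * (\<delta> * L) / 400"
    using n0 by (simp add: M_def)
  moreover have "d / 2 * (l / 36) = d * (\<delta> * L) / 288" by (simp add: l_def)
  moreover have "d * (\<delta> * L) > 0" using d0 \<delta> L0 by simp
  ultimately show False by linarith
qed

section \<open>Turan and Ramsey bounds from maximal independent sets\<close>

text \<open>The closed neighbourhoods of the members of a maximal independent set cover
  \<open>U\<close>; there are at most \<open>n - 1\<close> of them, each with at most
  \<open>D + 1\<close> vertices.\<close>

lemma card_le_of_degree_le:
  assumes U: "finite U" and indep: "indep_sets_of_size U E n = {}"
    and deg: "\<And>u. u \<in> U \<Longrightarrow> card (nbhd U E u) \<le> D"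
  shows "card U \<le> (n - 1) * (D + 1)"
proof -
  obtain W where W: "W \<in> indep_subsets U E"
    and max: "\<And>W'. W' \<in> indep_subsets U E \<Longrightarrow> W \<subseteq> W' \<Longrightarrow> W = W'"
    using finite_has_maximal[OF finite_indep_subsets[OF U], of E] empty_mem_indep_subsets[of U E]
    by (metis empty_iff)
  have WU: "W \<subseteq> U" "indep W E" using W by (auto simp: indep_subsets_def)
  have finW: "finite W" using finite_mem_indep_subsets[OF U W] .
  have "U \<subseteq> (\<Union>w\<in>W. insert w (nbhd U E w))"
  proof
    fix v assume v: "v \<in> U"
    show "v \<in> (\<Union>w\<in>W. insert w (nbhd U E w))"
    proof (rule ccontr)
      assume *: "v \<notin> (\<Union>w\<in>W. insert w (nbhd U E w))"
      then have "{v, w} \<notin> E" if "w \<in> W" for w using v that by (auto simp: in_nbhd_iff)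
      then have "indep (insert v W) E"
        using WU(2) by (auto simp: indep_def insert_commute)
      then have "insert v W \<in> indep_subsets U E" using v WU by (auto simp: indep_subsets_def)
      with max[of "insert v W"] * show False by auto
    qed
  qed
  then have "card U \<le> card (\<Union>w\<in>W. insert w (nbhd U E w))"
    using finW finite_common_nbhd[OF U] by (intro card_mono) auto
  also have "\<dots> \<le> (\<Sum>w\<in>W. card (insert w (nbhd U E w)))" by (rule card_UN_le[OF finW])
  also have "\<dots> \<le> (\<Sum>w\<in>W. D + 1)"
  proof (intro sum_mono)
    fix w assume "w \<in> W"
    then show "card (insert w (nbhd U E w)) \<le> D + 1"
      using deg[of w] WU card_insert_le_m1[of "D + 1" "nbhd U E w" w] by auto
  qed
  also have "\<dots> = card W * (D + 1)" by simp
  also have "\<dots> \<le> (n - 1) * (D + 1)"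
    using card_indep_subset_less[OF U indep W] by (intro mult_right_mono) auto
  finally show ?thesis .
qed

text \<open>With fewer edges, half of the vertices would have degree at most
  \<open>T = d / (4 * n)\<close>, and \<open>card_le_of_degree_le\<close> would leave fewer than
  \<open>n * 2 * T = d / 2\<close> of them. The hypothesis on \<open>d\<close> is
  \<open>T \<ge> 1\<close>, which allows rounding \<open>T + 1\<close> up to
  \<open>2 * T\<close>.\<close>

lemma edge_count_large:
  assumes U: "finite U" and indep: "indep_sets_of_size U E n = {}"
    and n: "n > 0" and d: "real (card U) \<ge> 4 * real n"
  shows "real (num_cliques U E 2) \<ge> (real (card U))\<^sup>2 / (16 * real n)"
proof (rule ccontr)
  assume contra: "\<not> ?thesis"
  define d where "d = real (card U)"
  define T where "T = d / (4 * real n)"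
  have T1: "T \<ge> 1" using d n by (simp add: T_def d_def)
  define H where "H = {u \<in> U. real (card (nbhd U E u)) > T}"
  have H: "real (card H) \<le> d / 2"
    unfolding H_def
  proof (rule card_large_values_le[OF U])
    have "(\<Sum>u\<in>U. real (card (nbhd U E u))) = 2 * real (num_cliques U E 2)"
      using sum_card_nbhd[OF U, of E] by (metis of_nat_sum of_nat_mult of_nat_numeral)
    also have "\<dots> \<le> d / 2 * T"
      using contra by (simp add: T_def d_def power2_eq_square)
    finally show "(\<Sum>u\<in>U. real (card (nbhd U E u))) \<le> d / 2 * T" .
  qed (use T1 in auto)
  define U' where "U' = U - H"
  have U'U: "U' \<subseteq> U" by (auto simp: U'_def)
  have finU': "finite U'" using U by (simp add: U'_def)
  have cardU': "real (card U') \<ge> d / 2"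
  proof -
    have "card U - card H \<le> card U'"
      unfolding U'_def by (rule diff_card_le_card_Diff) (use U in \<open>auto simp: H_def\<close>)
    then show ?thesis using H unfolding d_def by linarith
  qed
  have "card U' \<le> (n - 1) * (nat \<lfloor>T\<rfloor> + 1)"
  proof (rule card_le_of_degree_le[OF finU' indep_sets_of_size_subset_empty[OF U'U indep]])
    fix u assume u: "u \<in> U'"
    have "card (nbhd U' E u) \<le> card (nbhd U E u)"
      by (intro card_mono common_nbhd_mono U'U finite_common_nbhd U)
    moreover have "real (card (nbhd U E u)) \<le> T" using u by (auto simp: U'_def H_def)
    ultimately show "card (nbhd U' E u) \<le> nat \<lfloor>T\<rfloor>" by (simp add: le_nat_floor)
  qed
  then have "real (card U') \<le> real ((n - 1) * (nat \<lfloor>T\<rfloor> + 1))" by (simp only: of_nat_le_iff)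
  also have "\<dots> = (real n - 1) * (real (nat \<lfloor>T\<rfloor>) + 1)" using n by (subst of_nat_mult) (simp add: of_nat_diff)
  also have "\<dots> \<le> (real n - 1) * (2 * T)"
    using T1 n by (intro mult_left_mono) (auto, linarith)
  also have "\<dots> < real n * (2 * T)" using T1 by simp
  also have "\<dots> = d / 2" using n by (simp add: T_def)
  finally show False using cardU' by simp
qed

text \<open>A Ramsey bound: \<open>R(n, i + 1) \<le> n ^ i\<close>.\<close>

lemma num_cliques_pos:
  assumes "finite U" "indep_sets_of_size U E n = {}" "n > 0" "card U \<ge> n ^ i"
  shows "num_cliques U E (i + 1) > 0"
  using assms
proof (induction i arbitrary: U)
  case 0
  then show ?case using num_cliques_1[of U E] by simp
next
  case (Suc i)
  have "\<exists>u\<in>U. card (nbhd U E u) \<ge> n ^ i"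
  proof (rule ccontr)
    assume "\<not> ?thesis"
    then have "card (nbhd U E u) \<le> n ^ i - 1" if "u \<in> U" for u using that by fastforce
    from card_le_of_degree_le[OF Suc.prems(1,2) this]
    have "card U \<le> (n - 1) * n ^ i" using Suc.prems(3) by simp
    also have "\<dots> < n * n ^ i" using Suc.prems(3) by simp
    finally show False using Suc.prems(4) by simp
  qed
  then obtain u where u: "u \<in> U" "card (nbhd U E u) \<ge> n ^ i" by blast
  have "num_cliques (nbhd U E u) E (i + 1) > 0"
    using Suc.prems u(2) indep_sets_of_size_subset_empty[OF common_nbhd_subset Suc.prems(2)]
    by (intro Suc.IH finite_common_nbhd)
  also have "num_cliques (nbhd U E u) E (i + 1) \<le> (\<Sum>v\<in>U. num_cliques (nbhd U E v) E (i + 1))"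
    using u(1) Suc.prems(1) by (intro member_le_sum) auto
  also have "\<dots> = (1 + (i + 1) choose 1) * num_cliques U E (1 + (i + 1))"
    by (simp only: sum_over_cliques_1 flip: sum_num_cliques_common_nbhd[OF Suc.prems(1)])
  finally have "num_cliques U E (1 + (i + 1)) > 0" by (simp only: nat_0_less_mult_iff)
  then show ?case by simp
qed

subsection \<open>Ratios of consecutive clique counts\<close>

text \<open>Since \<open>x / 0 = 0\<close>, a positive ratio certifies that both clique counts are
  positive.\<close>

definition clique_ratio :: "'a set \<Rightarrow> 'a set set \<Rightarrow> nat \<Rightarrow> real" where
  "clique_ratio V E m = real (num_cliques V E (m + 1)) / real (num_cliques V E m)"

lemma clique_ratio_0: "clique_ratio V E 0 = real (card V)"
  using num_cliques_1[of V E] by (simp add: clique_ratio_def num_cliques_0)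

lemma clique_ratio_pos_iff:
  "clique_ratio V E m > 0 \<longleftrightarrow> num_cliques V E m > 0 \<and> num_cliques V E (m + 1) > 0"
  by (auto simp: clique_ratio_def zero_less_divide_iff)

lemma num_cliques_Suc_eq:
  "num_cliques V E m > 0 \<Longrightarrow>
    real (num_cliques V E (m + 1)) = clique_ratio V E m * real (num_cliques V E m)"
  by (simp add: clique_ratio_def)

text \<open>The average size of a common neighbourhood is \<open>(m + 1) * r\<close>. The cliques
  below half of this average contribute at most half of the total.\<close>

lemma sum_heavy_common_nbhd:
  fixes V :: "'a set" and E m
  defines "r \<equiv> clique_ratio V E m"
  assumes V: "finite V" and pos: "r > 0"
  shows "(\<Sum>Q | Q \<in> cliques_of_size V E m \<and> real (card (common_nbhd V E Q)) \<ge> real (m + 1) * r / 2.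
      real (card (common_nbhd V E Q))) \<ge> real (m + 1) * real (num_cliques V E (m + 1)) / 2"
proof -
  let ?C = "cliques_of_size V E m"
  let ?d = "\<lambda>Q. real (card (common_nbhd V E Q))"
  let ?a = "real (m + 1) * r / 2"
  have fin: "finite ?C" using V by (rule finite_cliques_of_size)
  have K: "real (num_cliques V E (m + 1)) = r * real (card ?C)"
    using pos num_cliques_Suc_eq[of V E m] unfolding r_def clique_ratio_pos_iff by blast
  have "(\<Sum>Q\<in>?C. card (common_nbhd V E Q)) = (m + 1) * num_cliques V E (m + 1)"
    using sum_num_cliques_common_nbhd[OF V, where E = E and m = m and l = 1] num_cliques_1[of _ E] by simp
  then have "(\<Sum>Q\<in>?C. ?d Q) = real (m + 1) * real (num_cliques V E (m + 1))"
    by (metis of_nat_mult of_nat_sum)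
  moreover have "(\<Sum>Q\<in>?C. ?d Q) = (\<Sum>Q | Q \<in> ?C \<and> ?d Q \<ge> ?a. ?d Q) + (\<Sum>Q | Q \<in> ?C \<and> \<not> ?d Q \<ge> ?a. ?d Q)"
    using fin by (subst sum.union_disjoint[symmetric]) (auto intro: sum.cong)
  moreover have "(\<Sum>Q | Q \<in> ?C \<and> \<not> ?d Q \<ge> ?a. ?d Q) \<le> (\<Sum>Q\<in>?C. ?a)"
  proof -
    have "(\<Sum>Q | Q \<in> ?C \<and> \<not> ?d Q \<ge> ?a. ?d Q) \<le> (\<Sum>Q | Q \<in> ?C \<and> \<not> ?d Q \<ge> ?a. ?a)"
      by (intro sum_mono) auto
    also have "\<dots> \<le> (\<Sum>Q\<in>?C. ?a)" using fin pos by (intro sum_mono2) auto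
    finally show ?thesis .
  qed
  moreover have "(\<Sum>Q\<in>?C. ?a) = real (m + 1) * real (num_cliques V E (m + 1)) / 2"
    unfolding K by simp
  ultimately show ?thesis by linarith
qed

lemma choose_two_real: "real ((m + 2) choose m) = (real m + 1) * (real m + 2) / 2"
proof (induction m)
  case (Suc m)
  have "Suc m + 2 choose Suc m = (m + 2 choose m) + (m + 2 choose Suc m)" by (simp only: add_Suc binomial_Suc_Suc)
  moreover have "m + 2 choose Suc m = m + 2" using binomial_symmetric[of "Suc m" "m + 2"] by simp
  ultimately show ?case using Suc by (simp add: field_simps)
qed simp

lemma choose_three_real: "real ((m + 3) choose m) = (real m + 1) * (real m + 2) * (real m + 3) / 6"
proof (induction m)
  case (Suc m)
  have "Suc m + 3 choose Suc m = (m + 3 choose m) + (m + 3 choose Suc m)" by (simp only: add_Suc binomial_Suc_Suc)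
  moreover have "real (m + 3 choose Suc m) = (real m + 2) * (real m + 3) / 2"
    using choose_two_real[of "Suc m"] by (simp add: eval_nat_numeral algebra_simps)
  ultimately show ?case using Suc by (simp add: field_simps)
qed simp

text \<open>Turan's bound is applied inside the common neighbourhood of each heavy
  \<open>m\<close>-clique. One of the two factors of the squared size is replaced by the threshold
  \<open>?a\<close>, so that the linear bound \<open>sum_heavy_common_nbhd\<close> applies. The
  condition on \<open>r\<close> gives \<open>?a \<ge> 4 * n\<close>, as
  \<open>edge_count_large\<close> requires.\<close>

lemma clique_ratio_Suc_ge:
  assumes V: "finite V" and indep: "indep_sets_of_size V E n = {}" and n: "n > 0"
    and r: "clique_ratio V E m \<ge> 8 * real n"
  shows "clique_ratio V E (m + 1) \<ge> clique_ratio V E m / (64 * real n)"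
proof -
  define r where "r = clique_ratio V E m"
  let ?d = "\<lambda>Q. real (card (common_nbhd V E Q))"
  let ?a = "real (m + 1) * r / 2"
  let ?H = "{Q. Q \<in> cliques_of_size V E m \<and> ?d Q \<ge> ?a}"
  have fin: "finite (cliques_of_size V E m)" using V by (rule finite_cliques_of_size)
  have r8: "r \<ge> 8 * real n" using r by (simp add: r_def)
  have r0: "r > 0" using r8 n by (smt (verit) of_nat_0_less_iff)
  have a: "?a \<ge> 4 * real n"
    using mult_mono[of 1 "real m + 1" "8 * real n" r] r8 by (simp add: algebra_simps)
  let ?K1 = "real (num_cliques V E (m + 1))"
  have K1: "?K1 > 0" using r0 by (simp add: r_def clique_ratio_pos_iff)
  have heavy: "real (m + 1) * ?K1 / 2 \<le> (\<Sum>Q\<in>?H. ?d Q)"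
    using sum_heavy_common_nbhd[OF V r0[unfolded r_def]] unfolding r_def .
  have "?a / (16 * real n) * (real (m + 1) * ?K1 / 2) \<le> ?a / (16 * real n) * (\<Sum>Q\<in>?H. ?d Q)"
    using heavy r0 by (intro mult_left_mono) auto
  also have "\<dots> = (\<Sum>Q\<in>?H. ?a / (16 * real n) * ?d Q)" by (rule sum_distrib_left)
  also have "\<dots> \<le> (\<Sum>Q\<in>?H. real (num_cliques (common_nbhd V E Q) E 2))"
  proof (rule sum_mono)
    fix Q assume "Q \<in> ?H"
    then have Q: "?d Q \<ge> ?a" by simp
    have "?a / (16 * real n) * ?d Q \<le> ?d Q / (16 * real n) * ?d Q"
      using Q by (intro mult_right_mono divide_right_mono) auto
    also have "\<dots> = (?d Q)\<^sup>2 / (16 * real n)" by (simp add: power2_eq_square)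
    also have "\<dots> \<le> real (num_cliques (common_nbhd V E Q) E 2)"
      using Q a n indep_sets_of_size_subset_empty[OF common_nbhd_subset indep]
      by (intro edge_count_large finite_common_nbhd V) auto
    finally show "?a / (16 * real n) * ?d Q \<le> real (num_cliques (common_nbhd V E Q) E 2)" .
  qed
  also have "\<dots> \<le> (\<Sum>Q\<in>cliques_of_size V E m. real (num_cliques (common_nbhd V E Q) E 2))"
    using fin by (intro sum_mono2) auto
  also have "\<dots> = real ((m + 2) choose m) * real (num_cliques V E (m + 2))"
    using sum_num_cliques_common_nbhd[OF V, where E = E and m = m and l = 2] by (metis of_nat_mult of_nat_sum)
  also note choose_two_real
  finally have "(real m + 1) * (real m + 2) / 2 * real (num_cliques V E (m + 2)) \<ge>
      ?a / (16 * real n) * (real (m + 1) * ?K1 / 2)" .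
  also have "?a / (16 * real n) * (real (m + 1) * ?K1 / 2) =
      (real m + 1) / 2 * ((real m + 1) / (32 * real n) * r * ?K1)" using n by (simp add: field_simps)
  finally have "(real m + 1) / 2 * ((real m + 1) / (32 * real n) * r * ?K1)
    \<le> (real m + 1) / 2 * ((real m + 2) * real (num_cliques V E (m + 2)))" by simp
  then have "(real m + 1) / (32 * real n) * r * ?K1 \<le> (real m + 2) * real (num_cliques V E (m + 2))"
    by (subst (asm) mult_le_cancel_left_pos) auto
  moreover have "(real m + 2) * (r / (64 * real n) * ?K1) \<le> (real m + 1) / (32 * real n) * r * ?K1"
    using r0 K1 n by (simp add: field_simps)
  ultimately have "(real m + 2) * (r / (64 * real n) * ?K1) \<le> (real m + 2) * real (num_cliques V E (m + 2))"
    by linarith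
  then have "r / (64 * real n) * ?K1 \<le> real (num_cliques V E (m + 2))"
    by (subst (asm) mult_le_cancel_left_pos) auto
  then have "r / (64 * real n) \<le> real (num_cliques V E (m + 2)) / ?K1"
    using K1 by (simp add: pos_le_divide_eq)
  also have "\<dots> = clique_ratio V E (m + 1)" by (simp add: clique_ratio_def)
  finally show ?thesis by (simp only: r_def)
qed

lemma clique_ratio_Suc_ge_log:
  assumes V: "finite V" and indep: "indep_sets_of_size V E n = {}"
    and \<delta>: "\<delta> > 0" and n: "\<delta> * ln (real n) \<ge> 5600"
    and r: "clique_ratio V E m \<ge> 2 * real n powr (1 + \<delta>)"
  shows "clique_ratio V E (m + 1) \<ge> \<delta> / 51200 * (ln (real n) / real n) * clique_ratio V E m
    \<or> clique_ratio V E (m + 1) * clique_ratio V E (m + 2)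
        \<ge> (clique_ratio V E m)\<^sup>2 * real n powr (- 2 - \<delta>) / 16"
proof -
  define r where "r = clique_ratio V E m"
  let ?d = "\<lambda>Q. real (card (common_nbhd V E Q))"
  let ?a = "real (m + 1) * r / 2"
  define H where "H = {Q. Q \<in> cliques_of_size V E m \<and> ?d Q \<ge> ?a}"
  have fin: "finite (cliques_of_size V E m)" using V by (rule finite_cliques_of_size)
  have finH: "finite H" using fin by (simp add: H_def)
  have n0: "n > 0" using n \<delta> by (cases "n = 0") auto
  have n\<delta>: "real n powr \<delta> \<ge> 4"
  proof -
    have "4 \<le> exp (\<delta> * ln (real n))"
      using exp_ge_add_one_self[of "\<delta> * ln (real n)"] n by linarith
    then show ?thesis using n0 by (simp add: powr_def)
  qed
  have r8: "r \<ge> 8 * real n"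
  proof -
    have "8 * real n \<le> 2 * (real n * real n powr \<delta>)" using n\<delta> n0 by simp
    also have "\<dots> \<le> r" using r n0 by (simp add: r_def powr_add)
    finally show ?thesis .
  qed
  have r0: "r > 0" using r8 n0 by (smt (verit) of_nat_0_less_iff)
  have "r / (64 * real n) \<le> clique_ratio V E (m + 1)"
    using clique_ratio_Suc_ge[OF V indep n0, of m] r8 by (simp add: r_def)
  \<comment> \<open>Positivity of this ratio gives \<open>K2 > 0\<close>, so that
    \<open>K3 / K1\<close> factors into two consecutive ratios in the triangle case.\<close>
  then have r1: "clique_ratio V E (m + 1) > 0" using r0 n0 by (smt (verit) divide_pos_pos of_nat_0_less_iff)
  define K1 K2 K3 where "K1 = real (num_cliques V E (m + 1))"
    and "K2 = real (num_cliques V E (m + 2))" and "K3 = real (num_cliques V E (m + 3))"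
  have K12: "K1 > 0" "K2 > 0" using r1 by (simp_all add: clique_ratio_pos_iff K1_def K2_def)
  have a: "?a \<ge> real n powr (1 + \<delta>)"
  proof -
    have "real n powr (1 + \<delta>) \<le> 1 * r / 2" using r by (simp add: r_def)
    also have "\<dots> \<le> ?a" using r0 by (intro divide_right_mono mult_right_mono) auto
    finally show ?thesis .
  qed
  define H1 where "H1 = {Q \<in> H. real (num_cliques (common_nbhd V E Q) E 2)
      \<ge> \<delta> / 6400 * (?d Q)\<^sup>2 * (ln (real n) / real n)}"
  have H1H: "H1 \<subseteq> H" by (auto simp: H1_def)
  have heavy: "real (m + 1) * K1 / 2 \<le> (\<Sum>Q\<in>H. ?d Q)"
    using sum_heavy_common_nbhd[OF V r0[unfolded r_def]] unfolding r_def H_def K1_def .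
  have "(\<Sum>Q\<in>H. ?d Q) = (\<Sum>Q\<in>H - H1. ?d Q) + (\<Sum>Q\<in>H1. ?d Q)"
    by (rule sum.subset_diff[OF H1H finH])
  \<comment> \<open>Each heavy clique satisfies one alternative of
    \<open>triangle_count_or_edge_count_large\<close>; one of the two classes carries half of the
    heavy sum.\<close>
  with heavy consider (edges) "real (m + 1) * K1 / 4 \<le> (\<Sum>Q\<in>H1. ?d Q)"
    | (triangles) "real (m + 1) * K1 / 4 \<le> (\<Sum>Q\<in>H - H1. ?d Q)" by linarith
  then show ?thesis
  proof cases
    case edges
    \<comment> \<open>The threshold and the share of the sum give
      \<open>K2 / K1 \<ge> t * r * (m + 1) / (4 * (m + 2))\<close>, at least
      \<open>t * r / 8\<close>; hence 51200 = 8 * 6400.\<close>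
    define t where "t = \<delta> / 6400 * (ln (real n) / real n)"
    have t0: "t \<ge> 0" using \<delta> n0 by (simp add: t_def)
    have "t * ?a * (real (m + 1) * K1 / 4) \<le> t * ?a * (\<Sum>Q\<in>H1. ?d Q)"
      using edges r0 t0 by (intro mult_left_mono) auto
    also have "\<dots> = (\<Sum>Q\<in>H1. t * ?a * ?d Q)" by (rule sum_distrib_left)
    also have "\<dots> \<le> (\<Sum>Q\<in>H1. real (num_cliques (common_nbhd V E Q) E 2))"
    proof (rule sum_mono)
      fix Q assume Q: "Q \<in> H1"
      have "t * ?a * ?d Q \<le> t * ?d Q * ?d Q"
        using Q t0 by (intro mult_right_mono mult_left_mono) (auto simp: H1_def H_def)
      also have "\<dots> = \<delta> / 6400 * (?d Q)\<^sup>2 * (ln (real n) / real n)"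
        by (simp add: t_def power2_eq_square)
      also have "\<dots> \<le> real (num_cliques (common_nbhd V E Q) E 2)"
        using Q by (simp add: H1_def)
      finally show "t * ?a * ?d Q \<le> real (num_cliques (common_nbhd V E Q) E 2)" .
    qed
    also have "\<dots> \<le> (\<Sum>Q\<in>cliques_of_size V E m. real (num_cliques (common_nbhd V E Q) E 2))"
      using fin by (intro sum_mono2) (auto simp: H1_def H_def)
    also have "\<dots> = real ((m + 2) choose m) * K2"
      using sum_num_cliques_common_nbhd[OF V, where E = E and m = m and l = 2]
      unfolding K2_def by (metis of_nat_mult of_nat_sum)
    also note choose_two_real
    finally have "(real m + 1) / 2 * ((real m + 1) / 4 * (t * r * K1)) \<le> (real m + 1) / 2 * ((real m + 2) * K2)"
      by (simp add: field_simps)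
    then have "(real m + 1) / 4 * (t * r * K1) \<le> (real m + 2) * K2"
      by (subst (asm) mult_le_cancel_left_pos) auto
    moreover have "(real m + 2) / 8 * (t * r * K1) \<le> (real m + 1) / 4 * (t * r * K1)"
      using t0 r0 K12 by (intro mult_right_mono) auto
    ultimately have "(real m + 2) * (t * r * K1 / 8) \<le> (real m + 2) * K2" by (simp add: field_simps)
    then have "t * r * K1 / 8 \<le> K2"
      by (subst (asm) mult_le_cancel_left_pos) auto
    then have "t / 8 * r \<le> clique_ratio V E (m + 1)"
      using K12 by (simp add: clique_ratio_def K1_def K2_def pos_le_divide_eq)
    then show ?thesis by (simp add: t_def r_def)
  next
    case triangles
    \<comment> \<open>As for edges, but two of the three factors of the cubed size are replaced by
      \<open>?a\<close>, leaving one linear factor for the heavy sum.\<close>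
    define t where "t = real n powr (- 2 - \<delta>)"
    have t0: "t \<ge> 0" by (simp add: t_def)
    have "t * ?a\<^sup>2 * (real (m + 1) * K1 / 4) \<le> t * ?a\<^sup>2 * (\<Sum>Q\<in>H - H1. ?d Q)"
      using triangles t0 by (intro mult_left_mono) auto
    also have "\<dots> = (\<Sum>Q\<in>H - H1. t * ?a\<^sup>2 * ?d Q)" by (rule sum_distrib_left)
    also have "\<dots> \<le> (\<Sum>Q\<in>H - H1. real (num_cliques (common_nbhd V E Q) E 3))"
    proof (rule sum_mono)
      fix Q assume Q: "Q \<in> H - H1"
      have dQ: "?d Q \<ge> ?a" using Q by (auto simp: H_def)
      have "t * ?a\<^sup>2 * ?d Q \<le> t * (?d Q)\<^sup>2 * ?d Q"
        using dQ r0 t0 by (intro mult_right_mono mult_left_mono power_mono) auto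
      also have "\<dots> = (?d Q) ^ 3 * real n powr (- 2 - \<delta>)"
        by (simp add: t_def power2_eq_square power3_eq_cube)
      also have "\<dots> \<le> real (num_cliques (common_nbhd V E Q) E 3)"
        using triangle_count_or_edge_count_large[OF finite_common_nbhd[OF V, of E Q]
            indep_sets_of_size_subset_empty[OF common_nbhd_subset indep] \<delta> n] dQ a Q
        by (auto simp: H1_def)
      finally show "t * ?a\<^sup>2 * ?d Q \<le> real (num_cliques (common_nbhd V E Q) E 3)" .
    qed
    also have "\<dots> \<le> (\<Sum>Q\<in>cliques_of_size V E m. real (num_cliques (common_nbhd V E Q) E 3))"
      using fin by (intro sum_mono2) (auto simp: H_def)
    also have "\<dots> = real ((m + 3) choose m) * K3"
      using sum_num_cliques_common_nbhd[OF V, where E = E and m = m and l = 3]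
      unfolding K3_def by (metis of_nat_mult of_nat_sum)
    also note choose_three_real
    finally have "(real m + 1) * ((real m + 1)\<^sup>2 / 16 * (t * r\<^sup>2 * K1))
      \<le> (real m + 1) * ((real m + 2) * (real m + 3) / 6 * K3)"
      by (simp add: power2_eq_square field_simps)
    then have "(real m + 1)\<^sup>2 / 16 * (t * r\<^sup>2 * K1) \<le> (real m + 2) * (real m + 3) / 6 * K3"
      by (subst (asm) mult_le_cancel_left_pos) auto
    moreover have "(real m + 2) * (real m + 3) / 6 / 16 * (t * r\<^sup>2 * K1) \<le> (real m + 1)\<^sup>2 / 16 * (t * r\<^sup>2 * K1)"
    proof (rule mult_right_mono)
      have "(real m + 2) * (real m + 3) \<le> 6 * (real m + 1)\<^sup>2"
        by (simp add: power2_eq_square algebra_simps)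
      then show "(real m + 2) * (real m + 3) / 6 / 16 \<le> (real m + 1)\<^sup>2 / 16" by simp
    qed (use t0 K12 in auto)
    ultimately have "(real m + 2) * (real m + 3) / 6 * (t * r\<^sup>2 * K1 / 16)
      \<le> (real m + 2) * (real m + 3) / 6 * K3" by linarith
    then have "t * r\<^sup>2 * K1 / 16 \<le> K3"
      by (subst (asm) mult_le_cancel_left_pos) auto
    then have "r\<^sup>2 * t / 16 \<le> K3 / K1" using K12 by (simp add: field_simps)
    also have "K3 / K1 = clique_ratio V E (m + 1) * clique_ratio V E (m + 2)"
      using K12 by (simp add: clique_ratio_def K1_def K2_def K3_def eval_nat_numeral)
    finally show ?thesis by (simp add: t_def r_def)
  qed
qed

section \<open>Clique counts from lower bounds on the ratios\<close>

lemma g_le: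
  assumes "n > 0"
  shows "g N i n \<le> real N ^ i * (ln (real n) / real n) ^ (i choose 2)"
proof -
  have "N choose i \<le> N ^ i" by (cases "i \<le> N") (auto simp: binomial_le_pow binomial_eq_0)
  then have "real (N choose i) \<le> real N ^ i" by (metis of_nat_le_iff of_nat_power)
  then show ?thesis unfolding g_def using assms by (intro mult_right_mono) auto
qed

lemma Suc_choose_2: "Suc j choose 2 = j + (j choose 2)"
  by (simp add: numeral_2_eq_2)

text \<open>The number of \<open>i\<close>-cliques is the product of the ratios with index below
  \<open>i\<close>, and these indices add up to \<open>i choose 2\<close>.\<close>

lemma num_cliques_ge_of_clique_ratio_ge:
  assumes x: "x > 0" and N: "N > 0"
    and ratio: "\<And>m. m < i \<Longrightarrow> clique_ratio V E m \<ge> N * x ^ m"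
  shows "real (num_cliques V E i) \<ge> N ^ i * x ^ (i choose 2)"
  using ratio
proof (induction i)
  case 0
  then show ?case by (simp add: num_cliques_0 binomial_eq_0)
next
  case (Suc i)
  have IH: "N ^ i * x ^ (i choose 2) \<le> real (num_cliques V E i)" using Suc by simp
  moreover have "N ^ i * x ^ (i choose 2) > 0" using x N by simp
  ultimately have pos: "num_cliques V E i > 0" by (metis less_le_trans of_nat_0_less_iff)
  have "N ^ Suc i * x ^ (Suc i choose 2) = (N * x ^ i) * (N ^ i * x ^ (i choose 2))"
    by (simp add: Suc_choose_2 power_add)
  also have "\<dots> \<le> clique_ratio V E i * real (num_cliques V E i)"
    using IH Suc.prems x N by (intro mult_mono) (auto intro: order_trans[OF _ Suc.prems])
  also have "\<dots> = real (num_cliques V E (Suc i))" using num_cliques_Suc_eq[OF pos] by simp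
  finally show ?case .
qed

text \<open>Iterated Turan bound; the size of \<open>V\<close> keeps every ratio along the way above
  the threshold \<open>8 * n\<close> of \<open>clique_ratio_Suc_ge\<close>.\<close>

lemma clique_ratio_ge_of_large:
  assumes V: "finite V" and indep: "indep_sets_of_size V E n = {}" and n: "n > 0"
    and N: "real (card V) \<ge> 8 * real n * (64 * real n) ^ k" and m: "m \<le> k"
  shows "clique_ratio V E m \<ge> real (card V) * (1 / (64 * real n)) ^ m"
  using m
proof (induction m)
  case 0
  then show ?case by (simp add: clique_ratio_0)
next
  case (Suc m)
  have IH: "clique_ratio V E m \<ge> real (card V) * (1 / (64 * real n)) ^ m" using Suc by simp
  have "8 * real n = 8 * real n * (64 * real n) ^ m * (1 / (64 * real n)) ^ m"
    using n by (simp add: power_divide)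
  also have "\<dots> \<le> 8 * real n * (64 * real n) ^ k * (1 / (64 * real n)) ^ m"
    using Suc.prems n by (intro mult_right_mono mult_left_mono power_increasing) auto
  also have "\<dots> \<le> real (card V) * (1 / (64 * real n)) ^ m"
    using N by (intro mult_right_mono) auto
  also note IH
  finally have "clique_ratio V E m / (64 * real n) \<le> clique_ratio V E (Suc m)"
    using clique_ratio_Suc_ge[OF V indep n, of m] by simp
  moreover have "real (card V) * (1 / (64 * real n)) ^ m / (64 * real n) \<le> clique_ratio V E m / (64 * real n)"
    using IH by (intro divide_right_mono) auto
  ultimately show ?case by simp
qed

section \<open>The case of bounded \<open>n\<close>\<close>

lemma ln_div_self_bounds:
  assumes "n \<ge> (1::nat)"
  shows "0 \<le> ln (real n) / real n" "ln (real n) / real n \<le> 1"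
  using assms ln_le_minus_one[of "real n"] by (auto simp: divide_le_eq_1)

text \<open>For \<open>n \<le> n0\<close> logarithms and powers of \<open>n\<close> are absorbed in
  the constant. If \<open>V\<close> is large, iterated Turan bounds suffice (\<open>?c1\<close>).
  Otherwise \<open>g\<close> is bounded, and the single clique given by the Ramsey bound suffices
  (\<open>?c2\<close>).\<close>

lemma num_cliques_ge_bounded:
  assumes V: "finite V" and indep: "indep_sets_of_size V E n = {}"
    and n: "1 \<le> n" "n \<le> n0" and N: "n ^ (k - 2) \<le> card V" and i: "0 < i" "i < k"
  shows "real (num_cliques V E i)
    \<ge> min ((1 / (64 * real n0)) ^ (k choose 2)) (1 / (8 * real n0 * (64 * real n0) ^ k) ^ k) * g (card V) i n"
    (is "_ \<ge> min ?c1 ?c2 * _")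
proof -
  have ik2: "i choose 2 \<le> k choose 2" using i by (intro binomial_right_mono) auto
  have "g (card V) i n \<le> real (card V) ^ i * (ln (real n) / real n) ^ (i choose 2)"
    using n by (intro g_le) auto
  also have "\<dots> \<le> real (card V) ^ i * 1"
    using ln_div_self_bounds[of n] n by (intro mult_left_mono power_le_one) auto
  finally have g: "g (card V) i n \<le> real (card V) ^ i" by simp
  have g0: "g (card V) i n \<ge> 0" using ln_div_self_bounds[of n] n by (simp add: g_def)
  show ?thesis
  proof (cases "real (card V) \<ge> 8 * real n * (64 * real n) ^ k")
    case True
    moreover have "8 * real n * (64 * real n) ^ k > 0" using n by simp
    ultimately have V0: "real (card V) > 0" by linarith
    have "?c1 * g (card V) i n \<le> ?c1 * real (card V) ^ i"
      using g by (intro mult_left_mono) auto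
    also have "\<dots> \<le> (1 / (64 * real n)) ^ (i choose 2) * real (card V) ^ i"
    proof (rule mult_right_mono)
      have "?c1 \<le> (1 / (64 * real n0)) ^ (i choose 2)"
        using ik2 n by (intro power_decreasing) auto
      also have "\<dots> \<le> (1 / (64 * real n)) ^ (i choose 2)"
        using n by (intro power_mono divide_left_mono) auto
      finally show "?c1 \<le> (1 / (64 * real n)) ^ (i choose 2)" .
    qed auto
    also have "\<dots> \<le> real (num_cliques V E i)"
      using num_cliques_ge_of_clique_ratio_ge[of "1 / (64 * real n)" "real (card V)" i V E]
        clique_ratio_ge_of_large[OF V indep _ True] n i V0 by (simp add: mult.commute)
    finally have "?c1 * g (card V) i n \<le> real (num_cliques V E i)" .
    moreover have "min ?c1 ?c2 * g (card V) i n \<le> ?c1 * g (card V) i n"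
      using g0 by (intro mult_right_mono) auto
    ultimately show ?thesis by linarith
  next
    case False
    define B where "B = 8 * real n0 * (64 * real n0) ^ k"
    have B1: "B \<ge> 1"
      unfolding B_def using n
      by (intro order_trans[OF _ mult_mono[of 1 "8 * real n0" 1 "(64 * real n0) ^ k"]] one_le_power) auto
    have "8 * real n * (64 * real n) ^ k \<le> B"
      unfolding B_def using n by (intro mult_mono power_mono) auto
    then have "real (card V) \<le> B" using False by linarith
    then have "real (card V) ^ i \<le> B ^ i" by (intro power_mono) auto
    also have "\<dots> \<le> B ^ k" using B1 i by (intro power_increasing) auto
    finally have "g (card V) i n \<le> B ^ k" using g by simp
    then have "?c2 * g (card V) i n \<le> 1"
      using B1 unfolding B_def[symmetric] by simp
    moreover have "num_cliques V E (i - 1 + 1) > 0"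
    proof (rule num_cliques_pos[OF V indep])
      have "n ^ (i - 1) \<le> n ^ (k - 2)" using n i by (intro power_increasing) auto
      then show "n ^ (i - 1) \<le> card V" using N by simp
    qed (use n in auto)
    then have "real (num_cliques V E i) \<ge> 1" using i by simp
    moreover have "min ?c1 ?c2 * g (card V) i n \<le> ?c2 * g (card V) i n"
      using g0 by (intro mult_right_mono) auto
    ultimately show ?thesis by linarith
  qed
qed

section \<open>The case of large \<open>n\<close>\<close>

text \<open>Thresholds for the large case: the first serves the edge-triangle dichotomy, the second
  makes the ratios large enough to apply it, and the last two turn an excess of triangles into too
  many \<open>k\<close>-cliques.\<close>

lemma eventually_asymptotic_conditions:
  fixes \<delta> c :: real and k :: nat
  assumes "\<delta> > 0" "c > 0"
  shows "eventually (\<lambda>n::nat. \<delta> * ln (real n) \<ge> 5600 \<and> c ^ k * real n powr \<delta> \<ge> 2 \<and>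
    c ^ k * real n powr \<delta> \<ge> 128 * 64 ^ k * ln (real n) \<and>
    c ^ (k * k + 2 * k) * real n powr \<delta> > 16 * ln (real n) ^ (k choose 2)) sequentially"
proof -
  have 1: "filterlim (\<lambda>n::nat. \<delta> * ln (real n)) at_top sequentially"
    using assms by real_asymp
  have 2: "(\<lambda>n::nat. (A * ln (real n) ^ p) / (real n powr \<delta>)) \<longlonglongrightarrow> 0" for A :: real and p :: nat
    using assms by real_asymp
  have 3: "eventually (\<lambda>n::nat. A * ln (real n) ^ p < b * real n powr \<delta>) sequentially"
    if "b > 0" for A b :: real and p :: nat
    using order_tendstoD(2)[OF 2[of A p] that] eventually_gt_at_top[of 0]
    by eventually_elim (simp add: divide_less_eq)
  have "c ^ k > 0" "c ^ (k * k + 2 * k) > 0" using assms by auto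
  note 3 [OF this(1), of 2 0] 3[OF this(1), of "128 * 64 ^ k" 1] 3[OF this(2), of 16 "k choose 2"]
    filterlim_at_top[THEN iffD1, OF 1, rule_format, of 5600]
  then show ?thesis by eventually_elim auto
qed

text \<open>If the growth of \<open>clique_ratio\<close> fails at \<open>m\<close>, then there are so many \<open>(m + 3)\<close>-cliques that all
  later ratios exceed \<open>N / n ^ q\<close>, which accounts for more \<open>k\<close>-cliques than allowed.\<close>

lemma many_cliques_of_triangle_excess:
  fixes V :: "'a set" and E :: "'a set set" and n :: nat and c \<epsilon> \<delta> :: real
  defines "N \<equiv> real (card V)" and "L \<equiv> ln (real n)"
  assumes V: "finite V" and indep: "indep_sets_of_size V E n = {}"
    and \<epsilon>: "0 < \<epsilon>" "\<epsilon> \<le> 1" and \<delta>: "\<delta> = \<epsilon> / 2" and c: "0 < c" "c \<le> 1"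
    and n: "n > 0" and L: "L \<ge> 1" and N: "N \<ge> real n powr (real k - 2 + \<epsilon>)"
    and large1: "c ^ k * real n powr \<delta> \<ge> 128 * 64 ^ k * L"
    and large2: "c ^ (k * k + 2 * k) * real n powr \<delta> > 16 * L ^ (k choose 2)"
    and m: "m + 3 \<le> k"
    and ratio: "\<And>q. q \<le> m \<Longrightarrow> clique_ratio V E q \<ge> c ^ q * N * (L / real n) ^ q"
    and small: "clique_ratio V E (m + 1) < c * (L / real n) * clique_ratio V E m"
    and excess: "clique_ratio V E (m + 1) * clique_ratio V E (m + 2)
        \<ge> (clique_ratio V E m)\<^sup>2 * real n powr (- 2 - \<delta>) / 16"
  shows "real (num_cliques V E k) > real n powr (1 - \<epsilon>) * g (card V) k n"
proof -
  \<comment> \<open>The benchmark for the ratio at \<open>q\<close> without constants and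
    logarithms. The lower bound on \<open>N\<close> says that it is at least
    \<open>n powr \<epsilon>\<close> for \<open>q \<le> k - 2\<close>.\<close>
  define s where "s q = N / real n ^ q" for q
  let ?r = "clique_ratio V E"
  have N0: "N > 0" using N n by (smt (verit) powr_gt_zero of_nat_0_less_iff)
  have s0: "s q > 0" for q using N0 n by (simp add: s_def)
  have s_Suc: "s (Suc q) = s q / real n" for q by (simp add: s_def)
  have s_ge: "s q \<ge> real n powr \<epsilon>" if "q + 2 \<le> k" for q
  proof -
    have "real n powr \<epsilon> \<le> real n powr (real k - 2 + \<epsilon> - real q)"
      using n that by (intro powr_mono) auto
    also have "\<dots> = real n powr (real k - 2 + \<epsilon>) / real n ^ q"
      using n by (simp add: powr_diff powr_realpow)
    also have "\<dots> \<le> s q" unfolding s_def using N by (intro divide_right_mono) auto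
    finally show ?thesis .
  qed
  have r_ge: "?r q \<ge> c ^ q * s q" if "q \<le> m" for q
  proof -
    have "1 * (c ^ q * s q) \<le> L ^ q * (c ^ q * s q)"
      using L s0[of q] c by (intro mult_right_mono one_le_power) auto
    also have "\<dots> = c ^ q * N * (L / real n) ^ q" by (simp add: s_def power_divide)
    also have "\<dots> \<le> ?r q" by (rule ratio[OF that])
    finally show ?thesis by simp
  qed
  have r_ge': "?r q \<ge> c ^ k * s q" if "q \<le> m" for q
  proof -
    have "c ^ k * s q \<le> c ^ q * s q"
      using that m c s0[of q] by (intro mult_right_mono power_decreasing) auto
    then show ?thesis using r_ge[OF that] by linarith
  qed
  have rm0: "?r m > 0" using r_ge[of m] c s0[of m] by (smt (verit) mult_pos_pos zero_less_power order_refl)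
  have np: "real n powr (- 2 - \<delta>) = 1 / ((real n)\<^sup>2 * real n powr \<delta>)"
    using n by (simp add: powr_diff powr_minus powr_realpow field_simps)
  have n\<delta>: "real n powr \<delta> > 0" using n by simp
  \<comment> \<open>This is where \<open>\<delta> = \<epsilon> / 2\<close> matters: the excess
    \<open>n powr (1 - \<delta>)\<close> equals \<open>n powr (1 - \<epsilon>)\<close> with a factor
    \<open>n powr \<delta>\<close> to spare for logarithms and constants.\<close>
  have n1: "real n powr (1 - \<epsilon>) * (real n powr \<delta> * real n powr \<delta>) = real n"
    using n by (simp add: \<delta> flip: powr_add)
  have r_nonneg: "?r q \<ge> 0" for q by (simp add: clique_ratio_def)
  have prod0: "?r (m + 1) * ?r (m + 2) > 0"
  proof -
    have "(?r m)\<^sup>2 * real n powr (- 2 - \<delta>) / 16 > 0" using rm0 n by simp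
    then show ?thesis using excess by linarith
  qed
  then have r12: "?r (m + 1) > 0" "?r (m + 2) > 0"
    using r_nonneg[of "m + 1"] r_nonneg[of "m + 2"] by (auto simp: zero_less_mult_iff)
  \<comment> \<open>Dividing \<open>excess\<close> by the upper bound \<open>small\<close> cancels
    one factor \<open>?r m\<close> and bounds \<open>?r (m + 2)\<close> alone. The factor
    \<open>64 ^ k\<close> is a reserve for later Turan steps.\<close>
  have r2: "?r (m + 2) \<ge> 64 ^ k * 8 * real n powr (1 - \<epsilon>) * s (m + 2)"
  proof -
    have "?r m * (?r m * real n powr (- 2 - \<delta>) / 16) \<le> ?r (m + 1) * ?r (m + 2)"
      using excess by (simp add: power2_eq_square)
    also have "\<dots> \<le> c * (L / real n) * ?r m * ?r (m + 2)"
      using small r12 by (intro mult_right_mono) auto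
    finally have "?r m * (?r m * real n powr (- 2 - \<delta>) / 16) \<le> ?r m * (c * (L / real n) * ?r (m + 2))"
      by (simp add: mult_ac)
    then have "?r m * real n powr (- 2 - \<delta>) / 16 \<le> c * (L / real n) * ?r (m + 2)"
      using rm0 by (subst (asm) mult_le_cancel_left_pos) auto
    also have "\<dots> \<le> 1 * (L / real n) * ?r (m + 2)"
      using c L r12 by (intro mult_right_mono) auto
    finally have *: "?r m * real n powr (- 2 - \<delta>) / 16 \<le> L / real n * ?r (m + 2)" by simp
    have "c ^ k * s m * real n powr (- 2 - \<delta>) / 16 \<le> ?r m * real n powr (- 2 - \<delta>) / 16"
      using r_ge'[of m] by (intro divide_right_mono mult_right_mono) auto
    with * have "c ^ k * s m * real n powr (- 2 - \<delta>) / 16 \<le> L / real n * ?r (m + 2)" by linarith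
    then have **: "c ^ k * s (m + 2) * real n / (16 * real n powr \<delta>) \<le> L * ?r (m + 2)"
      using n by (simp add: np s_Suc field_simps power2_eq_square)
    have "L * (64 ^ k * 8 * real n powr (1 - \<epsilon>) * s (m + 2)) =
        (128 * 64 ^ k * L) * (real n powr (1 - \<epsilon>) * s (m + 2) / 16)" by simp
    also have "\<dots> \<le> (c ^ k * real n powr \<delta>) * (real n powr (1 - \<epsilon>) * s (m + 2) / 16)"
      using large1 s0[of "m + 2"] by (intro mult_right_mono) auto
    also have "\<dots> = c ^ k * s (m + 2) * (real n powr (1 - \<epsilon>) * (real n powr \<delta> * real n powr \<delta>)) / (16 * real n powr \<delta>)"
      using n\<delta> by (simp add: field_simps)
    also note n1
    also note **
    finally show ?thesis using L by (subst (asm) mult_le_cancel_left_pos) auto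
  qed
  \<comment> \<open>Each Turan step costs a factor 64 from the reserve. The factor
    \<open>8 * n powr (1 - \<epsilon>)\<close> together with \<open>s_ge\<close> keeps the ratio at
    least \<open>8 * n\<close>, so the next step is allowed.\<close>
  have r_later: "?r (m + 2 + j) \<ge> 64 ^ (k - j) * 8 * real n powr (1 - \<epsilon>) * s (m + 2 + j)"
    if "m + 2 + j < k" for j
    using that
  proof (induction j)
    case 0
    then show ?case using r2 by simp
  next
    case (Suc j)
    let ?q = "m + 2 + j"
    have IH: "?r ?q \<ge> 64 ^ (k - j) * 8 * real n powr (1 - \<epsilon>) * s ?q" using Suc by simp
    have "8 * real n = 1 * 8 * real n powr (1 - \<epsilon>) * real n powr \<epsilon>"
      using n by (simp flip: powr_add)
    also have "\<dots> \<le> 64 ^ (k - j) * 8 * real n powr (1 - \<epsilon>) * s ?q"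
      using s_ge[of ?q] Suc.prems by (intro mult_mono one_le_power) auto
    also note IH
    finally have "?r (?q + 1) \<ge> ?r ?q / (64 * real n)"
      by (intro clique_ratio_Suc_ge[OF V indep n])
    moreover have "?r ?q / (64 * real n) \<ge> 64 ^ (k - j) * 8 * real n powr (1 - \<epsilon>) * s ?q / (64 * real n)"
      using IH by (intro divide_right_mono) auto
    moreover have "64 ^ (k - j) * 8 * real n powr (1 - \<epsilon>) * s ?q / (64 * real n)
        = 64 ^ (k - Suc j) * 8 * real n powr (1 - \<epsilon>) * s (m + 2 + Suc j)"
    proof -
      have "k - j = Suc (k - Suc j)" using Suc.prems by simp
      then show ?thesis by (simp add: s_Suc mult_ac)
    qed
    ultimately show ?case by simp
  qed
  have r_later': "?r q \<ge> s q" if q: "m + 2 \<le> q" "q < k" for q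
  proof -
    obtain j where j: "q = m + 2 + j" using le_Suc_ex[OF q(1)] ..
    have "real n powr (1 - \<epsilon>) \<ge> 1" using n \<epsilon> by (intro ge_one_powr_ge_zero) auto
    moreover have "(64::real) ^ (k - j) \<ge> 1" by (rule one_le_power) simp
    ultimately have "(64::real) ^ (k - j) * real n powr (1 - \<epsilon>) \<ge> 1"
      using mult_mono[of 1 "(64::real) ^ (k - j)" 1 "real n powr (1 - \<epsilon>)"] by simp
    then have "(64::real) ^ (k - j) * 8 * real n powr (1 - \<epsilon>) \<ge> 1" by simp
    then have "1 * s q \<le> 64 ^ (k - j) * 8 * real n powr (1 - \<epsilon>) * s q"
      using s0[of q] by (intro mult_right_mono) auto
    also have "\<dots> \<le> ?r q" using r_later[of j] q(2) unfolding j .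
    finally show ?thesis by simp
  qed
  define P where "P j = N ^ j / real n ^ (j choose 2)" for j
  have P0: "P j > 0" for j using N0 n by (simp add: P_def)
  have P_Suc: "P (Suc j) = s j * P j" for j by (simp add: P_def s_def Suc_choose_2 power_add)
  have early: "real (num_cliques V E j) \<ge> c ^ (k * j) * P j" if "j \<le> m + 1" for j
    using that
  proof (induction j)
    case 0
    then show ?case by (simp add: P_def num_cliques_0 binomial_eq_0)
  next
    case (Suc j)
    have IH: "c ^ (k * j) * P j \<le> real (num_cliques V E j)" using Suc by simp
    moreover have "c ^ (k * j) * P j > 0" using P0[of j] c by simp
    ultimately have pos: "num_cliques V E j > 0" by (metis less_le_trans of_nat_0_less_iff)
    have "c ^ (k * Suc j) * P (Suc j) = (c ^ k * s j) * (c ^ (k * j) * P j)"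
      by (simp add: P_Suc power_add)
    also have "\<dots> \<le> ?r j * real (num_cliques V E j)"
      using IH r_ge'[of j] Suc.prems c s0[of j] P0[of j]
      by (intro mult_mono) (auto intro: order_trans[OF _ r_ge'[of j]])
    also have "\<dots> = real (num_cliques V E (Suc j))" using num_cliques_Suc_eq[OF pos] by simp
    finally show ?case .
  qed
  \<comment> \<open>The gain over \<open>P\<close>: \<open>excess\<close> is of order
    \<open>(s m)\<^sup>2 * n powr (- 2 - \<delta>)\<close>, whereas
    \<open>s (m + 1) * s (m + 2) = (s m)\<^sup>2 / n ^ 3\<close>. The exponent of \<open>c\<close>
    collects \<open>k * k\<close> from the \<open>(m + 1)\<close>-cliques and \<open>2 * k\<close>
    from the squared ratio.\<close>
  define A where "A = c ^ (k * k + 2 * k) * real n powr (1 - \<delta>) / 16"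
  have A0: "A > 0" using c n by (simp add: A_def)
  have late: "real (num_cliques V E j) \<ge> A * P j" if "m + 3 \<le> j" "j \<le> k" for j
    using that
  proof (induction j rule: dec_induct)
    case base
    have pos: "num_cliques V E (m + 1) > 0" "num_cliques V E (m + 2) > 0"
      using r12 by (auto simp: clique_ratio_pos_iff)
    have "A * P (m + 3) = c ^ (k * k) * ((c ^ k * s m)\<^sup>2 * real n powr (- 2 - \<delta>) / 16) * P (m + 1)"
    proof -
      have "real n powr (1 - \<delta>) = real n / real n powr \<delta>" using n by (simp add: powr_diff)
      moreover have "P (m + 3) = s m / (real n)\<^sup>2 * (s m / real n) * P (m + 1)"
        using P_Suc[of "m + 2"] P_Suc[of "m + 1"]
        by (simp add: s_Suc eval_nat_numeral)
      moreover have "c ^ (k * k + 2 * k) = c ^ (k * k) * (c ^ k)\<^sup>2"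
        by (simp add: power_add power_mult[symmetric] mult.commute)
      ultimately show ?thesis
        using n by (simp add: A_def np power2_eq_square field_simps)
    qed
    also have "\<dots> = ((c ^ k * s m)\<^sup>2 * real n powr (- 2 - \<delta>) / 16) * (c ^ (k * k) * P (m + 1))"
      by simp
    also have "\<dots> \<le> ((?r m)\<^sup>2 * real n powr (- 2 - \<delta>) / 16) * real (num_cliques V E (m + 1))"
    proof (rule mult_mono)
      show "(c ^ k * s m)\<^sup>2 * real n powr (- 2 - \<delta>) / 16 \<le> (?r m)\<^sup>2 * real n powr (- 2 - \<delta>) / 16"
        using r_ge'[of m] c s0[of m] by (intro divide_right_mono mult_right_mono power_mono) auto
      have "c ^ (k * k) * P (m + 1) \<le> c ^ (k * (m + 1)) * P (m + 1)"
        using m c P0[of "m + 1"] by (intro mult_right_mono power_decreasing mult_le_mono) auto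
      then show "c ^ (k * k) * P (m + 1) \<le> real (num_cliques V E (m + 1))"
        using early[of "m + 1"] by linarith
    qed (use c P0[of "m + 1"] in auto)
    also have "\<dots> \<le> (?r (m + 1) * ?r (m + 2)) * real (num_cliques V E (m + 1))"
      using excess by (intro mult_right_mono) auto
    also have "\<dots> = real (num_cliques V E (m + 3))"
      using pos by (simp add: clique_ratio_def eval_nat_numeral)
    finally show ?case .
  next
    case (step j)
    have IH: "A * P j \<le> real (num_cliques V E j)" using step by simp
    moreover have "A * P j > 0" using P0[of j] A0 by simp
    ultimately have pos: "num_cliques V E j > 0" by (metis less_le_trans of_nat_0_less_iff)
    have rj: "?r j \<ge> s j" using step by (intro r_later') auto
    have "A * P (Suc j) = s j * (A * P j)" by (simp add: P_Suc)
    also have "\<dots> \<le> ?r j * real (num_cliques V E j)"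
      using IH rj s0[of j] A0 P0[of j] by (intro mult_mono) (auto intro: order_trans[OF _ rj])
    also have "\<dots> = real (num_cliques V E (Suc j))" using num_cliques_Suc_eq[OF pos] by simp
    finally show ?case .
  qed
  have "real n powr (1 - \<epsilon>) * g (card V) k n
      \<le> real n powr (1 - \<epsilon>) * (N ^ k * (L / real n) ^ (k choose 2))"
    using g_le[OF n, of "card V" k] by (intro mult_left_mono) (auto simp: N_def L_def)
  also have "\<dots> = real n powr (1 - \<epsilon>) / 16 * P k * (16 * L ^ (k choose 2))"
    by (simp add: P_def power_divide)
  also have "\<dots> < real n powr (1 - \<epsilon>) / 16 * P k * (c ^ (k * k + 2 * k) * real n powr \<delta>)"
    using large2 n P0[of k] by (intro mult_strict_left_mono) auto
  also have "\<dots> = A * P k"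
  proof -
    have "real n powr (1 - \<epsilon>) * real n powr \<delta> = real n powr (1 - \<delta>)"
      by (simp add: \<delta> flip: powr_add)
    then show ?thesis by (simp add: A_def)
  qed
  also have "\<dots> \<le> real (num_cliques V E k)" using late[of k] m by simp
  finally show ?thesis .
qed

text \<open>If the growth from \<open>p\<close> to \<open>p + 1\<close> failed, the triangle
  alternative of \<open>clique_ratio_Suc_ge_log\<close> would hold, and
  \<open>many_cliques_of_triangle_excess\<close> would contradict \<open>few\<close>. The latter
  uses the bounds at all \<open>q \<le> p\<close>, hence the strong induction.\<close>

lemma clique_ratio_ge_log:
  fixes V :: "'a set" and E :: "'a set set" and n :: nat and c \<epsilon> \<delta> :: real
  defines "N \<equiv> real (card V)" and "L \<equiv> ln (real n)"
  assumes V: "finite V" and indep: "indep_sets_of_size V E n = {}"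
    and \<epsilon>: "0 < \<epsilon>" "\<epsilon> \<le> 1" and \<delta>: "\<delta> = \<epsilon> / 2" and c: "c = \<delta> / 51200"
    and N: "N \<ge> real n powr (real k - 2 + \<epsilon>)"
    and large0: "\<delta> * L \<ge> 5600" "c ^ k * real n powr \<delta> \<ge> 2"
    and large1: "c ^ k * real n powr \<delta> \<ge> 128 * 64 ^ k * L"
    and large2: "c ^ (k * k + 2 * k) * real n powr \<delta> > 16 * L ^ (k choose 2)"
    and few: "real (num_cliques V E k) \<le> real n powr (1 - \<epsilon>) * g (card V) k n"
    and m: "m + 2 \<le> k"
  shows "clique_ratio V E m \<ge> c ^ m * N * (L / real n) ^ m"
  using m
proof (induction m rule: less_induct)
  case (less m)
  have \<delta>0: "0 < \<delta>" "\<delta> \<le> 1" using \<epsilon> by (auto simp: \<delta>)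
  have c01: "0 < c" "c \<le> 1" using \<delta>0 by (auto simp: c)
  have n: "n > 0" using large0(1) by (cases "n = 0") (auto simp: L_def)
  have L1: "L \<ge> 1"
  proof (rule ccontr)
    assume "\<not> L \<ge> 1"
    then have "\<delta> * L \<le> \<delta> * 1" using \<delta>0 by (intro mult_left_mono) auto
    then show False using large0 \<delta>0 by linarith
  qed
  show ?case
  proof (cases m)
    case 0
    then show ?thesis by (simp add: clique_ratio_0 N_def)
  next
    case (Suc p)
    have IH: "clique_ratio V E q \<ge> c ^ q * N * (L / real n) ^ q" if "q \<le> p" for q
      using less that Suc by auto
    \<comment> \<open>Here \<open>p + 3 \<le> k\<close>, so \<open>N / n ^ p\<close> is at least
      \<open>n powr (1 + \<epsilon>)\<close>; as \<open>\<epsilon> = 2 * \<delta>\<close>, a factor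
      \<open>n powr \<delta>\<close> remains to absorb the constants.\<close>
    have "2 * real n powr (1 + \<delta>) \<le> c ^ k * real n powr \<delta> * real n powr (1 + \<delta>)"
      using large0(2) by (intro mult_right_mono) auto
    also have "\<dots> = c ^ k * real n powr (1 + \<epsilon>)"
      by (simp add: \<delta> mult.assoc add.commute flip: powr_add)
    also have "\<dots> \<le> c ^ p * (real n powr (real k - 2 + \<epsilon>) / real n ^ p)"
    proof (rule mult_mono)
      show "c ^ k \<le> c ^ p" using c01 less.prems Suc by (intro power_decreasing) auto
      have "real n powr (1 + \<epsilon>) \<le> real n powr (real k - 2 + \<epsilon> - real p)"
        using n less.prems Suc by (intro powr_mono) auto
      also have "\<dots> = real n powr (real k - 2 + \<epsilon>) / real n ^ p"
        using n by (simp add: powr_diff powr_realpow)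
      finally show "real n powr (1 + \<epsilon>) \<le> real n powr (real k - 2 + \<epsilon>) / real n ^ p" .
    qed (use c01 in auto)
    also have "\<dots> \<le> c ^ p * (N / real n ^ p)"
      using N c01 by (intro mult_left_mono divide_right_mono) auto
    also have "\<dots> = (c ^ p * (N / real n ^ p)) * 1" by simp
    also have "\<dots> \<le> (c ^ p * (N / real n ^ p)) * L ^ p"
      using L1 c01 by (intro mult_left_mono one_le_power) (auto simp: N_def)
    also have "\<dots> = c ^ p * N * (L / real n) ^ p" by (simp add: power_divide)
    also have "\<dots> \<le> clique_ratio V E p" by (rule IH) simp
    finally have big: "clique_ratio V E p \<ge> 2 * real n powr (1 + \<delta>)" .
    have "clique_ratio V E (p + 1) \<ge> c * (L / real n) * clique_ratio V E p"
    proof (rule ccontr)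
      assume "\<not> ?thesis"
      then have small: "clique_ratio V E (p + 1) < c * (L / real n) * clique_ratio V E p" by simp
      with clique_ratio_Suc_ge_log[OF V indep \<delta>0(1) large0(1)[unfolded L_def] big]
      have excess: "clique_ratio V E (p + 1) * clique_ratio V E (p + 2)
        \<ge> (clique_ratio V E p)\<^sup>2 * real n powr (- 2 - \<delta>) / 16"
        by (auto simp: c L_def)
      have "real (num_cliques V E k) > real n powr (1 - \<epsilon>) * g (card V) k n"
        using less.prems Suc
        by (intro many_cliques_of_triangle_excess[OF V indep \<epsilon> \<delta> c01 n L1[unfolded L_def]
              N[unfolded N_def] large1[unfolded L_def] large2[unfolded L_def] _
              IH[unfolded L_def N_def] small[unfolded L_def] excess]) auto
      then show False using few by linarith
    qed
    moreover have "c * (L / real n) * (c ^ p * N * (L / real n) ^ p) \<le> c * (L / real n) * clique_ratio V E p"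
      using IH[of p] c01 L1 by (intro mult_left_mono) auto
    ultimately show ?thesis by (simp add: Suc mult_ac)
  qed
qed

theorem theorem1p4:
  fixes k :: nat and \<epsilon> :: real
  assumes "k \<ge> 2" and "\<epsilon> > 0"
  shows "\<exists>c::real. c > 0 \<and>
    (\<forall>(n::nat) (N::nat) (V::'a set) (E::'a set set).
       n \<ge> 2 \<longrightarrow> N \<ge> 1 \<longrightarrow>
       fin_simple_graph V E \<longrightarrow> card V = N \<longrightarrow>
       indep_sets_of_size V E n = {} \<longrightarrow>
       real N \<ge> real n powr (real k - 2 + \<epsilon>) \<longrightarrow>
       real (card (cliques_of_size V E k)) \<le> real n powr (1 - \<epsilon>) * g N k n \<longrightarrow>
       (\<forall>i::nat. 0 < i \<longrightarrow> i < k \<longrightarrow> real (card (cliques_of_size V E i)) \<ge> c * g N i n))"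
proof -
  \<comment> \<open>Decreasing \<open>\<epsilon>\<close> to at most 1 weakens both assumptions on
    the graph and ensures \<open>n powr (1 - \<epsilon>') \<ge> 1\<close>.\<close>
  define \<epsilon>' where "\<epsilon>' = min \<epsilon> 1"
  define \<delta> where "\<delta> = \<epsilon>' / 2"
  define c where "c = \<delta> / 51200"
  have \<epsilon>': "0 < \<epsilon>'" "\<epsilon>' \<le> 1" "\<epsilon>' \<le> \<epsilon>" using assms by (auto simp: \<epsilon>'_def)
  have \<delta>: "0 < \<delta>" using \<epsilon>' by (simp add: \<delta>_def)
  have c: "0 < c" "c \<le> 1" using \<epsilon>' by (auto simp: c_def \<delta>_def)
  obtain n0 where n0: "\<And>n. n \<ge> n0 \<Longrightarrow> \<delta> * ln (real n) \<ge> 5600 \<and> c ^ k * real n powr \<delta> \<ge> 2 \<and>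
    c ^ k * real n powr \<delta> \<ge> 128 * 64 ^ k * ln (real n) \<and>
    c ^ (k * k + 2 * k) * real n powr \<delta> > 16 * ln (real n) ^ (k choose 2)"
    using eventually_asymptotic_conditions[OF \<delta> c(1), of k] unfolding eventually_sequentially by blast
  define n1 where "n1 = max n0 1"
  \<comment> \<open>The constant for \<open>n < n0\<close>; for larger \<open>n\<close> it is
    \<open>c ^ (k choose 2)\<close>, from multiplying the ratio bounds.\<close>
  define c' where "c' = min ((1 / (64 * real n1)) ^ (k choose 2)) (1 / (8 * real n1 * (64 * real n1) ^ k) ^ k)"
  have "n1 > 0" by (simp add: n1_def)
  then have c': "c' > 0" by (simp add: c'_def)
  show ?thesis
  proof (intro exI[of _ "min (c ^ (k choose 2)) c'"] conjI allI impI)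
    show "min (c ^ (k choose 2)) c' > 0" using c c' by simp
  next
    fix n N :: nat and V :: "'a set" and E :: "'a set set" and i :: nat
    assume n: "n \<ge> 2" and N1: "N \<ge> 1" and "fin_simple_graph V E" and cardV: "card V = N"
      and indep: "indep_sets_of_size V E n = {}"
      and N: "real N \<ge> real n powr (real k - 2 + \<epsilon>)"
      and few: "real (card (cliques_of_size V E k)) \<le> real n powr (1 - \<epsilon>) * g N k n"
      and i: "0 < i" "i < k"
    have V: "finite V" using \<open>fin_simple_graph V E\<close> by (simp add: fin_simple_graph_def)
    have g0: "g N j n \<ge> 0" for j using n by (simp add: g_def)
    have "c ^ (k choose 2) * g N i n \<le> real (num_cliques V E i) \<or> c' * g N i n \<le> real (num_cliques V E i)"
    proof (cases "n \<ge> n0")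
      case True
      have "real n powr (real k - 2 + \<epsilon>') \<le> real n powr (real k - 2 + \<epsilon>)"
        using n \<epsilon>' by (intro powr_mono) auto
      then have N': "real (card V) \<ge> real n powr (real k - 2 + \<epsilon>')" using N cardV by simp
      have "real n powr (1 - \<epsilon>) * g N k n \<le> real n powr (1 - \<epsilon>') * g N k n"
        using n \<epsilon>' g0 by (intro mult_right_mono powr_mono) auto
      then have few': "real (num_cliques V E k) \<le> real n powr (1 - \<epsilon>') * g (card V) k n"
        using few cardV by simp
      let ?x = "c * (ln (real n) / real n)"
      have "clique_ratio V E m \<ge> real (card V) * ?x ^ m" if "m < i" for m
        using clique_ratio_ge_log[OF V indep \<epsilon>'(1,2) \<delta>_def c_def N' _ _ _ _ few', of m] n0[OF True] that i
        by (simp add: power_mult_distrib power_divide mult_ac)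
      then have "real N ^ i * ?x ^ (i choose 2) \<le> real (num_cliques V E i)"
        using n c N1 cardV by (intro num_cliques_ge_of_clique_ratio_ge) auto
      moreover have "c ^ (k choose 2) * g N i n \<le> c ^ (i choose 2) * (real N ^ i * (ln (real n) / real n) ^ (i choose 2))"
        using n c i g0 g_le[of n N i] by (intro mult_mono power_decreasing binomial_right_mono) auto
      ultimately show ?thesis
        by (simp add: power_mult_distrib power_divide mult_ac)
    next
      case False
      have "real (n ^ (k - 2)) = real n powr (real k - 2)"
        using n assms(1) by (simp add: powr_realpow[symmetric] of_nat_diff)
      also have "\<dots> \<le> real n powr (real k - 2 + \<epsilon>)" using n assms by (intro powr_mono) auto
      finally have "n ^ (k - 2) \<le> card V" using N cardV by linarith
      from num_cliques_ge_bounded[OF V indep _ _ this i, of n1] n False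
      show ?thesis by (simp add: c'_def n1_def cardV)
    qed
    moreover have "min (c ^ (k choose 2)) c' * g N i n \<le> c ^ (k choose 2) * g N i n"
      "min (c ^ (k choose 2)) c' * g N i n \<le> c' * g N i n"
      using g0 by (auto intro!: mult_right_mono)
    ultimately show "real (card (cliques_of_size V E i)) \<ge> min (c ^ (k choose 2)) c' * g N i n"
      by linarith
  qed
qed

end
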